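(* Let $\mathbb{E}$ be an exact $\mathrm{Equ}$-saturating protomodular category. Let $(f,s)$ be a split epimorphism $f:X\to Y$, $s:Y\to X$, $fs=1_Y$, and $(g,t)$ a split epimorphism $g:V\to W$, $t:W\to V$, $gt=1_W$, and let $k:X\to V$, $h:Y\to W$ be regular epimorphisms with $gk=hf$ and $ks=th$. Then the morphism $(h,k):(f,s)\to(g,t)$ has a universal decomposition as follows: there are a split epimorphism $(\bar f,\bar s)$, $\bar f:\bar X\to\bar Y$, $\bar f\bar s=1_{\bar Y}$, and morphisms of split epimorphisms $(\bar h,\bar k):(f,s)\to(\bar f,\bar s)$ and $(\check h,\check k):(\bar f,\bar s)\to(g,t)$ with $h=\check h\bar h$, $k=\check k\bar k$, such that $\bar h$ is a regular epimorphism and the square $\bar f\bar k=\bar h f$ is a pullback; and for any other such decomposition $(h,k)=(\check\chi,\check\kappa)\circ(\bar\chi,\bar\kappa)$ through a split epimorphism $(f',s')$, $f':X'\to Y'$, with $\bar\chi$ a regular epimorphism and the square $f'\bar\kappa=\bar\chi f$ a pullback, there is a unique morphism of split epimorphisms $(\tilde\chi,\tilde\kappa):(f',s')\to(\bar f,\bar s)$ with $\tilde\chi\bar\chi=\bar h$, $\tilde\kappa\bar\kappa=\bar k$, $\check h\tilde\chi=\check\chi$ and $\check k\tilde\kappa=\check\kappa$.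
   Context: Exact means Barr-exact. A morphism of split epimorphisms $(f,s)\to(g,t)$ is a pair $(h,k)$ with $h$ between codomains, $k$ between domains, such that $gk=hf$ and $ks=th$. A finitely complete category is protomodular when, for the fibration of points (split epimorphisms sent to their codomain), every base-change functor (pullback along a map) reflects isomorphisms. In a finitely complete category, a monomorphism $u:U\rightarrowtail X$ is saturated with respect to an internal equivalence relation $T$ on $X$ when the square formed by $u^{-1}T\to T$, $u$ and the projections $d_0$ (from $u^{-1}T$ to $U$ and from $T$ to $X$) is a pullback, where $u^{-1}T$ is the inverse image of $T$ along $u$. A finitely complete category is $\mathrm{Equ}$-saturating when, for any monomorphism $u:U\rightarrowtail X$ and any internal equivalence relation $S$ on $U$, among the internal equivalence relations $T$ on $X$ such that $u$ is saturated with respect to $T$ and $u^{-1}T\subset S$, there is a largest one. *)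

theory Defs
  imports Main
begin

record ('o, 'a) cat =
  Obj :: "'o set"
  Arr :: "'a set"
  Dom :: "'a \<Rightarrow> 'o"
  Cod :: "'a \<Rightarrow> 'o"
  Ident :: "'o \<Rightarrow> 'a"
  Comp :: "'a \<Rightarrow> 'a \<Rightarrow> 'a"  (infixr "\<cdot>\<index>" 70)

definition Hom :: "('o, 'a) cat \<Rightarrow> 'o \<Rightarrow> 'o \<Rightarrow> 'a set" where
  "Hom C x y = {f \<in> Arr C. Dom C f = x \<and> Cod C f = y}"

text \<open>Composition is written in applicative order and is unspecified on non-composable pairs.\<close>

locale category =
  fixes C :: "('o, 'a) cat" (structure)
  assumes Dom_Obj: "f \<in> Arr C \<Longrightarrow> Dom C f \<in> Obj C"
    and Cod_Obj: "f \<in> Arr C \<Longrightarrow> Cod C f \<in> Obj C"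
    and Ident_Hom: "x \<in> Obj C \<Longrightarrow> Ident C x \<in> Hom C x x"
    and Comp_Hom: "f \<in> Hom C x y \<Longrightarrow> g \<in> Hom C y z \<Longrightarrow> g \<cdot> f \<in> Hom C x z"
    and Comp_Ident: "f \<in> Hom C x y \<Longrightarrow> f \<cdot> Ident C x = f"
    and Ident_Comp: "f \<in> Hom C x y \<Longrightarrow> Ident C y \<cdot> f = f"
    and Comp_assoc: "f \<in> Hom C w x \<Longrightarrow> g \<in> Hom C x y \<Longrightarrow> h \<in> Hom C y z \<Longrightarrow>
      (h \<cdot> g) \<cdot> f = h \<cdot> (g \<cdot> f)"

definition is_functor ::
    "('i, 'j) cat \<Rightarrow> ('o, 'a) cat \<Rightarrow> ('i \<Rightarrow> 'o) \<Rightarrow> ('j \<Rightarrow> 'a) \<Rightarrow> bool" where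
  "is_functor J C Fo Fa \<longleftrightarrow>
    (\<forall>i\<in>Obj J. Fo i \<in> Obj C) \<and>
    (\<forall>i j. \<forall>\<alpha>\<in>Hom J i j. Fa \<alpha> \<in> Hom C (Fo i) (Fo j)) \<and>
    (\<forall>i\<in>Obj J. Fa (Ident J i) = Ident C (Fo i)) \<and>
    (\<forall>i j k. \<forall>\<alpha>\<in>Hom J i j. \<forall>\<beta>\<in>Hom J j k. Fa (\<beta> \<cdot>\<^bsub>J\<^esub> \<alpha>) = Fa \<beta> \<cdot>\<^bsub>C\<^esub> Fa \<alpha>)"

definition is_cone ::
    "('i, 'j) cat \<Rightarrow> ('o, 'a) cat \<Rightarrow> ('i \<Rightarrow> 'o) \<Rightarrow> ('j \<Rightarrow> 'a) \<Rightarrow> 'o \<Rightarrow> ('i \<Rightarrow> 'a) \<Rightarrow> bool" where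
  "is_cone J C Fo Fa L l \<longleftrightarrow>
    L \<in> Obj C \<and>
    (\<forall>i\<in>Obj J. l i \<in> Hom C L (Fo i)) \<and>
    (\<forall>i j. \<forall>\<alpha>\<in>Hom J i j. Fa \<alpha> \<cdot>\<^bsub>C\<^esub> l i = l j)"

definition is_limit ::
    "('i, 'j) cat \<Rightarrow> ('o, 'a) cat \<Rightarrow> ('i \<Rightarrow> 'o) \<Rightarrow> ('j \<Rightarrow> 'a) \<Rightarrow> 'o \<Rightarrow> ('i \<Rightarrow> 'a) \<Rightarrow> bool" where
  "is_limit J C Fo Fa L l \<longleftrightarrow>
    is_cone J C Fo Fa L l \<and>
    (\<forall>M m. is_cone J C Fo Fa M m \<longrightarrow>
      (\<exists>!w. w \<in> Hom C M L \<and> (\<forall>i\<in>Obj J. l i \<cdot>\<^bsub>C\<^esub> w = m i)))"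

text \<open>Every finite category is isomorphic to one whose objects and arrows are natural numbers,
  so quantifying over index categories of type \<open>(nat, nat) cat\<close> is no restriction.\<close>

definition finitely_complete :: "('o, 'a) cat \<Rightarrow> bool" where
  "finitely_complete C \<longleftrightarrow>
    category C \<and>
    (\<forall>(J :: (nat, nat) cat) Fo Fa.
      category J \<and> finite (Obj J) \<and> finite (Arr J) \<and> is_functor J C Fo Fa \<longrightarrow>
      (\<exists>L l. is_limit J C Fo Fa L l))"

definition monic :: "('o, 'a) cat \<Rightarrow> 'a \<Rightarrow> bool" where
  "monic C u \<longleftrightarrow>
    u \<in> Arr C \<and>
    (\<forall>z. \<forall>a\<in>Hom C z (Dom C u). \<forall>b\<in>Hom C z (Dom C u). u \<cdot>\<^bsub>C\<^esub> a = u \<cdot>\<^bsub>C\<^esub> b \<longrightarrow> a = b)"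

text \<open>\<open>is_pullback C p q f g\<close>: the square \<open>f \<cdot> p = g \<cdot> q\<close> is a pullback, so that \<open>p\<close> is the
  pullback of \<open>g\<close> along \<open>f\<close> and \<open>q\<close> is the pullback of \<open>f\<close> along \<open>g\<close>.\<close>

definition is_pullback :: "('o, 'a) cat \<Rightarrow> 'a \<Rightarrow> 'a \<Rightarrow> 'a \<Rightarrow> 'a \<Rightarrow> bool" where
  "is_pullback C p q f g \<longleftrightarrow>
    p \<in> Hom C (Dom C p) (Dom C f) \<and>
    q \<in> Hom C (Dom C p) (Dom C g) \<and>
    f \<in> Hom C (Dom C f) (Cod C f) \<and>
    g \<in> Hom C (Dom C g) (Cod C f) \<and>
    f \<cdot>\<^bsub>C\<^esub> p = g \<cdot>\<^bsub>C\<^esub> q \<and>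
    (\<forall>z. \<forall>a\<in>Hom C z (Dom C f). \<forall>b\<in>Hom C z (Dom C g). f \<cdot>\<^bsub>C\<^esub> a = g \<cdot>\<^bsub>C\<^esub> b \<longrightarrow>
      (\<exists>!w. w \<in> Hom C z (Dom C p) \<and> p \<cdot>\<^bsub>C\<^esub> w = a \<and> q \<cdot>\<^bsub>C\<^esub> w = b))"

definition is_coequalizer :: "('o, 'a) cat \<Rightarrow> 'a \<Rightarrow> 'a \<Rightarrow> 'a \<Rightarrow> bool" where
  "is_coequalizer C q a b \<longleftrightarrow>
    q \<in> Arr C \<and>
    a \<in> Hom C (Dom C a) (Dom C q) \<and>
    b \<in> Hom C (Dom C a) (Dom C q) \<and>
    q \<cdot>\<^bsub>C\<^esub> a = q \<cdot>\<^bsub>C\<^esub> b \<and>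
    (\<forall>z. \<forall>c\<in>Hom C (Dom C q) z. c \<cdot>\<^bsub>C\<^esub> a = c \<cdot>\<^bsub>C\<^esub> b \<longrightarrow>
      (\<exists>!w. w \<in> Hom C (Cod C q) z \<and> w \<cdot>\<^bsub>C\<^esub> q = c))"

definition regular_epi :: "('o, 'a) cat \<Rightarrow> 'a \<Rightarrow> bool" where
  "regular_epi C q \<longleftrightarrow> (\<exists>a b. is_coequalizer C q a b)"

definition kernel_pair :: "('o, 'a) cat \<Rightarrow> 'a \<Rightarrow> 'a \<Rightarrow> 'a \<Rightarrow> bool" where
  "kernel_pair C a b f \<longleftrightarrow> is_pullback C a b f f"

definition regular_category :: "('o, 'a) cat \<Rightarrow> bool" where
  "regular_category C \<longleftrightarrow>
    finitely_complete C \<and>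
    (\<forall>a b f. kernel_pair C a b f \<longrightarrow> (\<exists>q. is_coequalizer C q a b)) \<and>
    (\<forall>p q f g. is_pullback C p q f g \<and> regular_epi C g \<longrightarrow> regular_epi C p)"

text \<open>An internal relation on \<open>X\<close> is a jointly monic pair of arrows into \<open>X\<close>; reflexivity, symmetry
  and transitivity are witnessed by arrows \<open>r\<close>, \<open>\<sigma>\<close> and \<open>m\<close>, the last one defined on the object of
  composable pairs.\<close>

definition equivalence_relation :: "('o, 'a) cat \<Rightarrow> 'o \<Rightarrow> 'a \<Rightarrow> 'a \<Rightarrow> bool" where
  "equivalence_relation C X d\<^sub>0 d\<^sub>1 \<longleftrightarrow>
    d\<^sub>0 \<in> Hom C (Dom C d\<^sub>0) X \<and>
    d\<^sub>1 \<in> Hom C (Dom C d\<^sub>0) X \<and>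
    (\<forall>z. \<forall>a\<in>Hom C z (Dom C d\<^sub>0). \<forall>b\<in>Hom C z (Dom C d\<^sub>0).
      d\<^sub>0 \<cdot>\<^bsub>C\<^esub> a = d\<^sub>0 \<cdot>\<^bsub>C\<^esub> b \<and> d\<^sub>1 \<cdot>\<^bsub>C\<^esub> a = d\<^sub>1 \<cdot>\<^bsub>C\<^esub> b \<longrightarrow> a = b) \<and>
    (\<exists>r\<in>Hom C X (Dom C d\<^sub>0). d\<^sub>0 \<cdot>\<^bsub>C\<^esub> r = Ident C X \<and> d\<^sub>1 \<cdot>\<^bsub>C\<^esub> r = Ident C X) \<and>
    (\<exists>\<sigma>\<in>Hom C (Dom C d\<^sub>0) (Dom C d\<^sub>0). d\<^sub>0 \<cdot>\<^bsub>C\<^esub> \<sigma> = d\<^sub>1 \<and> d\<^sub>1 \<cdot>\<^bsub>C\<^esub> \<sigma> = d\<^sub>0) \<and>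
    (\<exists>p\<^sub>0 p\<^sub>1. is_pullback C p\<^sub>0 p\<^sub>1 d\<^sub>1 d\<^sub>0 \<and>
      (\<exists>m\<in>Hom C (Dom C p\<^sub>0) (Dom C d\<^sub>0).
        d\<^sub>0 \<cdot>\<^bsub>C\<^esub> m = d\<^sub>0 \<cdot>\<^bsub>C\<^esub> p\<^sub>0 \<and> d\<^sub>1 \<cdot>\<^bsub>C\<^esub> m = d\<^sub>1 \<cdot>\<^bsub>C\<^esub> p\<^sub>1))"

definition exact_category :: "('o, 'a) cat \<Rightarrow> bool" where
  "exact_category C \<longleftrightarrow>
    regular_category C \<and>
    (\<forall>X d\<^sub>0 d\<^sub>1. equivalence_relation C X d\<^sub>0 d\<^sub>1 \<longrightarrow> (\<exists>f. kernel_pair C d\<^sub>0 d\<^sub>1 f))"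

definition split_epi :: "('o, 'a) cat \<Rightarrow> 'a \<Rightarrow> 'a \<Rightarrow> bool" where
  "split_epi C f s \<longleftrightarrow>
    f \<in> Arr C \<and> s \<in> Hom C (Cod C f) (Dom C f) \<and> f \<cdot>\<^bsub>C\<^esub> s = Ident C (Cod C f)"

text \<open>\<open>point_mor C f s g t h k\<close>: the pair \<open>(h, k)\<close> is a morphism of split epimorphisms
  \<open>(f, s) \<rightarrow> (g, t)\<close>, with \<open>h\<close> between the codomains and \<open>k\<close> between the domains.\<close>

definition point_mor ::
    "('o, 'a) cat \<Rightarrow> 'a \<Rightarrow> 'a \<Rightarrow> 'a \<Rightarrow> 'a \<Rightarrow> 'a \<Rightarrow> 'a \<Rightarrow> bool" where
  "point_mor C f s g t h k \<longleftrightarrow>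
    split_epi C f s \<and> split_epi C g t \<and>
    h \<in> Hom C (Cod C f) (Cod C g) \<and> k \<in> Hom C (Dom C f) (Dom C g) \<and>
    g \<cdot>\<^bsub>C\<^esub> k = h \<cdot>\<^bsub>C\<^esub> f \<and> k \<cdot>\<^bsub>C\<^esub> s = t \<cdot>\<^bsub>C\<^esub> h"

definition cartesian_mor ::
    "('o, 'a) cat \<Rightarrow> 'a \<Rightarrow> 'a \<Rightarrow> 'a \<Rightarrow> 'a \<Rightarrow> 'a \<Rightarrow> 'a \<Rightarrow> bool" where
  "cartesian_mor C f s g t h k \<longleftrightarrow> point_mor C f s g t h k \<and> is_pullback C k f g h"

text \<open>Morphisms and isomorphisms in the fibre over the common codomain of the split epimorphisms.\<close>

definition fibre_mor ::
    "('o, 'a) cat \<Rightarrow> 'a \<Rightarrow> 'a \<Rightarrow> 'a \<Rightarrow> 'a \<Rightarrow> 'a \<Rightarrow> bool" where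
  "fibre_mor C f s g t k \<longleftrightarrow>
    Cod C f = Cod C g \<and> point_mor C f s g t (Ident C (Cod C f)) k"

definition fibre_iso ::
    "('o, 'a) cat \<Rightarrow> 'a \<Rightarrow> 'a \<Rightarrow> 'a \<Rightarrow> 'a \<Rightarrow> 'a \<Rightarrow> bool" where
  "fibre_iso C f s g t k \<longleftrightarrow>
    fibre_mor C f s g t k \<and>
    (\<exists>l. fibre_mor C g t f s l \<and>
      l \<cdot>\<^bsub>C\<^esub> k = Ident C (Dom C f) \<and> k \<cdot>\<^bsub>C\<^esub> l = Ident C (Dom C g))"

text \<open>\<open>base_change C h f s g t k f' s' g' t' k'\<close>: the fibre morphism \<open>k' : (f', s') \<rightarrow> (g', t')\<close> is
  obtained from \<open>k : (f, s) \<rightarrow> (g, t)\<close> by pulling back along \<open>h\<close>. As a relation it covers every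
  choice of the pullbacks, hence every version of the base-change functor.\<close>

definition base_change ::
    "('o, 'a) cat \<Rightarrow> 'a \<Rightarrow> 'a \<Rightarrow> 'a \<Rightarrow> 'a \<Rightarrow> 'a \<Rightarrow> 'a \<Rightarrow> 'a \<Rightarrow> 'a \<Rightarrow> 'a \<Rightarrow> 'a \<Rightarrow> 'a \<Rightarrow> bool" where
  "base_change C h f s g t k f' s' g' t' k' \<longleftrightarrow>
    fibre_mor C f s g t k \<and> fibre_mor C f' s' g' t' k' \<and>
    (\<exists>p q. cartesian_mor C f' s' f s h p \<and> cartesian_mor C g' t' g t h q \<and>
      q \<cdot>\<^bsub>C\<^esub> k' = k \<cdot>\<^bsub>C\<^esub> p)"

definition protomodular :: "('o, 'a) cat \<Rightarrow> bool" where
  "protomodular C \<longleftrightarrow>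
    finitely_complete C \<and>
    (\<forall>h f s g t k f' s' g' t' k'.
      base_change C h f s g t k f' s' g' t' k' \<and> fibre_iso C f' s' g' t' k' \<longrightarrow>
      fibre_iso C f s g t k)"

text \<open>The pair \<open>(e\<^sub>0, e\<^sub>1)\<close> is the inverse image along \<open>u : U \<rightarrow> X\<close> of the relation \<open>(d\<^sub>0, d\<^sub>1)\<close> on \<open>X\<close>,
  with canonical arrow \<open>v\<close>: this spells out the pullback of \<open>\<langle>d\<^sub>0, d\<^sub>1\<rangle> : T \<rightarrow> X \<times> X\<close> along
  \<open>u \<times> u : U \<times> U \<rightarrow> X \<times> X\<close>.\<close>

definition inverse_image ::
    "('o, 'a) cat \<Rightarrow> 'a \<Rightarrow> 'a \<Rightarrow> 'a \<Rightarrow> 'a \<Rightarrow> 'a \<Rightarrow> 'a \<Rightarrow> bool" where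
  "inverse_image C u d\<^sub>0 d\<^sub>1 e\<^sub>0 e\<^sub>1 v \<longleftrightarrow>
    u \<in> Arr C \<and>
    d\<^sub>0 \<in> Hom C (Dom C d\<^sub>0) (Cod C u) \<and> d\<^sub>1 \<in> Hom C (Dom C d\<^sub>0) (Cod C u) \<and>
    e\<^sub>0 \<in> Hom C (Dom C e\<^sub>0) (Dom C u) \<and> e\<^sub>1 \<in> Hom C (Dom C e\<^sub>0) (Dom C u) \<and>
    v \<in> Hom C (Dom C e\<^sub>0) (Dom C d\<^sub>0) \<and>
    d\<^sub>0 \<cdot>\<^bsub>C\<^esub> v = u \<cdot>\<^bsub>C\<^esub> e\<^sub>0 \<and> d\<^sub>1 \<cdot>\<^bsub>C\<^esub> v = u \<cdot>\<^bsub>C\<^esub> e\<^sub>1 \<and>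
    (\<forall>z. \<forall>a\<in>Hom C z (Dom C u). \<forall>b\<in>Hom C z (Dom C u). \<forall>c\<in>Hom C z (Dom C d\<^sub>0).
      d\<^sub>0 \<cdot>\<^bsub>C\<^esub> c = u \<cdot>\<^bsub>C\<^esub> a \<and> d\<^sub>1 \<cdot>\<^bsub>C\<^esub> c = u \<cdot>\<^bsub>C\<^esub> b \<longrightarrow>
      (\<exists>!w. w \<in> Hom C z (Dom C e\<^sub>0) \<and>
        e\<^sub>0 \<cdot>\<^bsub>C\<^esub> w = a \<and> e\<^sub>1 \<cdot>\<^bsub>C\<^esub> w = b \<and> v \<cdot>\<^bsub>C\<^esub> w = c))"

definition relation_le :: "('o, 'a) cat \<Rightarrow> 'a \<Rightarrow> 'a \<Rightarrow> 'a \<Rightarrow> 'a \<Rightarrow> bool" where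
  "relation_le C r\<^sub>0 r\<^sub>1 s\<^sub>0 s\<^sub>1 \<longleftrightarrow>
    (\<exists>j\<in>Hom C (Dom C r\<^sub>0) (Dom C s\<^sub>0). s\<^sub>0 \<cdot>\<^bsub>C\<^esub> j = r\<^sub>0 \<and> s\<^sub>1 \<cdot>\<^bsub>C\<^esub> j = r\<^sub>1)"

definition saturated :: "('o, 'a) cat \<Rightarrow> 'a \<Rightarrow> 'a \<Rightarrow> 'a \<Rightarrow> bool" where
  "saturated C u d\<^sub>0 d\<^sub>1 \<longleftrightarrow>
    (\<exists>e\<^sub>0 e\<^sub>1 v. inverse_image C u d\<^sub>0 d\<^sub>1 e\<^sub>0 e\<^sub>1 v \<and> is_pullback C v e\<^sub>0 d\<^sub>0 u)"

definition inverse_image_le :: "('o, 'a) cat \<Rightarrow> 'a \<Rightarrow> 'a \<Rightarrow> 'a \<Rightarrow> 'a \<Rightarrow> 'a \<Rightarrow> bool" where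
  "inverse_image_le C u d\<^sub>0 d\<^sub>1 s\<^sub>0 s\<^sub>1 \<longleftrightarrow>
    (\<exists>e\<^sub>0 e\<^sub>1 v. inverse_image C u d\<^sub>0 d\<^sub>1 e\<^sub>0 e\<^sub>1 v \<and> relation_le C e\<^sub>0 e\<^sub>1 s\<^sub>0 s\<^sub>1)"

definition Equ_saturating :: "('o, 'a) cat \<Rightarrow> bool" where
  "Equ_saturating C \<longleftrightarrow>
    finitely_complete C \<and>
    (\<forall>u s\<^sub>0 s\<^sub>1. monic C u \<and> equivalence_relation C (Dom C u) s\<^sub>0 s\<^sub>1 \<longrightarrow>
      (\<exists>d\<^sub>0 d\<^sub>1.
        equivalence_relation C (Cod C u) d\<^sub>0 d\<^sub>1 \<and>
        saturated C u d\<^sub>0 d\<^sub>1 \<and> inverse_image_le C u d\<^sub>0 d\<^sub>1 s\<^sub>0 s\<^sub>1 \<and>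
        (\<forall>t\<^sub>0 t\<^sub>1.
          equivalence_relation C (Cod C u) t\<^sub>0 t\<^sub>1 \<and>
          saturated C u t\<^sub>0 t\<^sub>1 \<and> inverse_image_le C u t\<^sub>0 t\<^sub>1 s\<^sub>0 s\<^sub>1 \<longrightarrow>
          relation_le C t\<^sub>0 t\<^sub>1 d\<^sub>0 d\<^sub>1)))"

text \<open>A decomposition \<open>(h, k) = (h\<^sub>2, k\<^sub>2) \<circ> (h\<^sub>1, k\<^sub>1)\<close> of \<open>(h, k) : (f, s) \<rightarrow> (g, t)\<close> through the split
  epimorphism \<open>(f', s')\<close>, whose first factor is cartesian over a regular epimorphism.\<close>

definition decomposition ::
    "('o, 'a) cat \<Rightarrow> 'a \<Rightarrow> 'a \<Rightarrow> 'a \<Rightarrow> 'a \<Rightarrow> 'a \<Rightarrow> 'a \<Rightarrow>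
      'a \<Rightarrow> 'a \<Rightarrow> 'a \<Rightarrow> 'a \<Rightarrow> 'a \<Rightarrow> 'a \<Rightarrow> bool" where
  "decomposition C f s g t h k f' s' h\<^sub>1 k\<^sub>1 h\<^sub>2 k\<^sub>2 \<longleftrightarrow>
    split_epi C f' s' \<and>
    point_mor C f s f' s' h\<^sub>1 k\<^sub>1 \<and> point_mor C f' s' g t h\<^sub>2 k\<^sub>2 \<and>
    h = h\<^sub>2 \<cdot>\<^bsub>C\<^esub> h\<^sub>1 \<and> k = k\<^sub>2 \<cdot>\<^bsub>C\<^esub> k\<^sub>1 \<and>
    regular_epi C h\<^sub>1 \<and> is_pullback C k\<^sub>1 f f' h\<^sub>1"

end

theory Submission
  imports Defs
begin

text \<open>Let \<open>T\<close> be the largest equivalence relation on \<open>X\<close> for which \<open>s\<close> is saturated with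
  \<open>s\<^sup>-\<^sup>1T \<subseteq> R[h]\<close>; the required decomposition consists of the quotients by \<open>T\<close> and \<open>s\<^sup>-\<^sup>1T\<close>. By
  protomodularity, \<open>s\<^sup>-\<^sup>1T\<close> and the diagonal are jointly epic into \<open>T\<close>, so an arrow out of \<open>X\<close> is
  constant on \<open>T\<close> as soon as its restriction along \<open>s\<close> is constant on \<open>s\<^sup>-\<^sup>1T\<close>. Hence \<open>k\<close> and
  \<open>f\<close> descend to the quotients. Protomodularity also makes \<open>T \<rightarrow> s\<^sup>-\<^sup>1T\<close> a discrete fibration, so
  that the quotient square is a pullback by the Barr-Kock theorem. Conversely, \<open>s\<close> is saturated for the kernel
  pair of the upper arrow of any competing cartesian morphism, which hence lies in \<open>T\<close>.\<close>

context category
begin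

section \<open>Equational calculus of composites\<close>

lemma comp_simps [simp]:
  assumes "f \<in> Arr C" and "g \<in> Arr C" and "Cod C f = Dom C g"
  shows "g \<cdot> f \<in> Arr C" and "Dom C (g \<cdot> f) = Dom C f" and "Cod C (g \<cdot> f) = Cod C g"
  using Comp_Hom[of f "Dom C f" "Cod C f" g "Cod C g"] assms by (auto simp: Hom_def)

lemma ident_simps [simp]:
  assumes "x \<in> Obj C"
  shows "Ident C x \<in> Arr C" and "Dom C (Ident C x) = x" and "Cod C (Ident C x) = x"
  using Ident_Hom[OF assms] by (auto simp: Hom_def)

lemma comp_ident [simp]: "f \<in> Arr C \<Longrightarrow> x = Dom C f \<Longrightarrow> f \<cdot> Ident C x = f"
  using Comp_Ident[of f x "Cod C f"] by (simp add: Hom_def)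

lemma ident_comp [simp]: "f \<in> Arr C \<Longrightarrow> x = Cod C f \<Longrightarrow> Ident C x \<cdot> f = f"
  using Ident_Comp[of f "Dom C f" x] by (simp add: Hom_def)

lemma comp_assoc [simp]:
  assumes "f \<in> Arr C" and "g \<in> Arr C" and "h \<in> Arr C"
    and "Cod C f = Dom C g" and "Cod C g = Dom C h"
  shows "(h \<cdot> g) \<cdot> f = h \<cdot> (g \<cdot> f)"
  using Comp_assoc[of f "Dom C f" "Dom C g" g "Dom C h" h "Cod C h"] assms by (simp add: Hom_def)

text \<open>\<open>comp_assoc\<close> nests composites to the right, so a known equation
  \<open>g \<cdot> f = l\<close> no longer matches inside \<open>g \<cdot> (f \<cdot> x)\<close>.
  This form restores it as a rewrite rule there.\<close>

lemma comp_extend: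
  assumes "g \<cdot> f = l" and "f \<in> Arr C" and "g \<in> Arr C" and "x \<in> Arr C"
    and "Cod C f = Dom C g" and "Cod C x = Dom C f"
  shows "g \<cdot> (f \<cdot> x) = l \<cdot> x"
  using assms comp_assoc by metis

lemma HomD:
  assumes "f \<in> Hom C x y"
  shows "f \<in> Arr C" and "Dom C f = x" and "Cod C f = y" and "x \<in> Obj C" and "y \<in> Obj C"
  using assms Dom_Obj Cod_Obj by (auto simp: Hom_def)

lemma comp_in_Hom: "g \<in> Hom C y z \<Longrightarrow> f \<in> Hom C x y \<Longrightarrow> g \<cdot> f \<in> Hom C x z"
  by (rule Comp_Hom)

section \<open>Pullbacks, coequalizers and regular epimorphisms\<close>

text \<open>Unique factorization is split into existence and joint monicity of \<open>p\<close> and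
  \<open>q\<close>, which usually need different arguments.\<close>

lemma is_pullbackI:
  assumes "p \<in> Hom C P A" and "q \<in> Hom C P B" and "f \<in> Hom C A D" and "g \<in> Hom C B D"
    and "f \<cdot> p = g \<cdot> q"
    and "\<And>z a b. a \<in> Hom C z A \<Longrightarrow> b \<in> Hom C z B \<Longrightarrow> f \<cdot> a = g \<cdot> b \<Longrightarrow>
      \<exists>w\<in>Hom C z P. p \<cdot> w = a \<and> q \<cdot> w = b"
    and "\<And>z w w'. w \<in> Hom C z P \<Longrightarrow> w' \<in> Hom C z P \<Longrightarrow> p \<cdot> w = p \<cdot> w' \<Longrightarrow> q \<cdot> w = q \<cdot> w' \<Longrightarrow> w = w'"
  shows "is_pullback C p q f g"
proof -
  have "\<exists>!w. w \<in> Hom C z P \<and> p \<cdot> w = a \<and> q \<cdot> w = b"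
    if "a \<in> Hom C z A" "b \<in> Hom C z B" "f \<cdot> a = g \<cdot> b" for z a b
    using assms(6)[OF that] assms(7) by (metis (no_types))
  then show ?thesis
    using assms(1-5) by (auto simp: is_pullback_def Hom_def)
qed

lemma is_pullbackD:
  assumes "is_pullback C p q f g"
  shows "p \<in> Hom C (Dom C p) (Dom C f)" and "q \<in> Hom C (Dom C p) (Dom C g)"
    and "f \<in> Hom C (Dom C f) (Cod C f)" and "g \<in> Hom C (Dom C g) (Cod C f)"
    and "f \<cdot> p = g \<cdot> q"
  using assms by (simp_all add: is_pullback_def)

lemma is_pullback_simps:
  assumes "is_pullback C p q f g"
  shows "p \<in> Arr C" and "q \<in> Arr C" and "f \<in> Arr C" and "g \<in> Arr C"
    and "Cod C p = Dom C f" and "Dom C q = Dom C p" and "Cod C q = Dom C g" and "Cod C g = Cod C f"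
  using assms by (auto simp: is_pullback_def Hom_def)

lemma pullback_factor:
  assumes "is_pullback C p q f g" and "a \<in> Hom C z (Dom C f)" and "b \<in> Hom C z (Dom C g)"
    and "f \<cdot> a = g \<cdot> b"
  obtains w where "w \<in> Hom C z (Dom C p)" and "p \<cdot> w = a" and "q \<cdot> w = b"
  using assms unfolding is_pullback_def by blast

lemma pullback_unique:
  assumes "is_pullback C p q f g" and w: "w \<in> Hom C z (Dom C p)" "w' \<in> Hom C z (Dom C p)"
    and eq: "p \<cdot> w = p \<cdot> w'" "q \<cdot> w = q \<cdot> w'"
  shows "w = w'"
proof -
  note pb = is_pullbackD[OF assms(1)]
  note [simp] = is_pullback_simps[OF assms(1)] HomD[OF w(1)]
  have "p \<cdot> w \<in> Hom C z (Dom C f)" "q \<cdot> w \<in> Hom C z (Dom C g)"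
    by (rule comp_in_Hom[OF pb(1) w(1)], rule comp_in_Hom[OF pb(2) w(1)])
  moreover have "f \<cdot> (p \<cdot> w) = g \<cdot> (q \<cdot> w)"
    by (simp add: comp_extend[OF pb(5)])
  ultimately have "\<exists>!v. v \<in> Hom C z (Dom C p) \<and> p \<cdot> v = p \<cdot> w \<and> q \<cdot> v = q \<cdot> w"
    using assms(1) unfolding is_pullback_def by blast
  then show ?thesis
    using w eq by metis
qed

lemma coequalizerD:
  assumes "is_coequalizer C q a b"
  shows "q \<in> Arr C" and "a \<in> Hom C (Dom C a) (Dom C q)" and "b \<in> Hom C (Dom C a) (Dom C q)"
    and "q \<cdot> a = q \<cdot> b"
  using assms by (simp_all add: is_coequalizer_def)

lemma coequalizer_factor:
  assumes "is_coequalizer C q a b" and "c \<in> Hom C (Dom C q) z" and "c \<cdot> a = c \<cdot> b"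
  obtains w where "w \<in> Hom C (Cod C q) z" and "w \<cdot> q = c"
  using assms unfolding is_coequalizer_def by blast

lemma regular_epi_cancel:
  assumes "regular_epi C q" and w: "w \<in> Hom C (Cod C q) z" "w' \<in> Hom C (Cod C q) z"
    and eq: "w \<cdot> q = w' \<cdot> q"
  shows "w = w'"
proof -
  obtain a b where q: "is_coequalizer C q a b"
    using assms(1) by (auto simp: regular_epi_def)
  note co = coequalizerD[OF q]
  note [simp] = co(1) HomD(1-3)[OF co(2)] HomD(1-3)[OF co(3)] HomD(1-3)[OF w(1)]
  have "w \<cdot> q \<in> Hom C (Dom C q) z"
    by (simp add: Hom_def)
  moreover have "(w \<cdot> q) \<cdot> a = (w \<cdot> q) \<cdot> b"
    by (simp add: co(4))
  ultimately have "\<exists>!v. v \<in> Hom C (Cod C q) z \<and> v \<cdot> q = w \<cdot> q"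
    using q unfolding is_coequalizer_def by blast
  then show ?thesis
    using w eq by metis
qed

section \<open>Pullbacks, equalizers and kernel pairs from finite limits\<close>

lemma pullback_exists:
  assumes "finitely_complete C" and f: "f \<in> Hom C A D" and g: "g \<in> Hom C B D"
  obtains p q where "is_pullback C p q f g"
proof -
  \<comment> \<open>\<open>J\<close> is the cospan \<open>0 -> 2 <- 1\<close>: the arrows below
    \<open>3\<close> are the identities, named like their objects, and \<open>3\<close>,
    \<open>4\<close> are the two legs. Every composable pair contains an identity, so the composite
    is \<open>\<beta>\<close> if \<open>\<alpha>\<close> is one and \<open>\<alpha>\<close>
    otherwise.\<close>
  define J :: "(nat, nat) cat" where
    "J = \<lparr>Obj = {0,1,2}, Arr = {0,1,2,3,4},
          Dom = (\<lambda>\<alpha>. if \<alpha> = 3 then 0 else if \<alpha> = 4 then 1 else \<alpha>),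
          Cod = (\<lambda>\<alpha>. if \<alpha> = 3 \<or> \<alpha> = 4 then 2 else \<alpha>),
          Ident = (\<lambda>i. i), Comp = (\<lambda>\<beta> \<alpha>. if \<alpha> < 3 then \<beta> else \<alpha>)\<rparr>"
  define Fo where "Fo = (\<lambda>i::nat. if i = 0 then A else if i = 1 then B else D)"
  define Fa where "Fa = (\<lambda>\<alpha>::nat. if \<alpha> = 3 then f else if \<alpha> = 4 then g else Ident C (Fo \<alpha>))"
  note [simp] = HomD[OF f] HomD[OF g]
  have J: "category J" "finite (Obj J)" "finite (Arr J)"
    by (unfold_locales) (auto simp: J_def Hom_def split: if_splits)
  have F: "is_functor J C Fo Fa"
    unfolding is_functor_def by (auto simp: J_def Hom_def Fo_def Fa_def split: if_splits)
  obtain L l where L: "is_limit J C Fo Fa L l"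
    using assms(1) J F unfolding finitely_complete_def by blast
  have cone: "is_cone J C Fo Fa M m \<longleftrightarrow> m 0 \<in> Hom C M A \<and> m 1 \<in> Hom C M B \<and>
      m 2 \<in> Hom C M D \<and> f \<cdot> m 0 = m 2 \<and> g \<cdot> m 1 = m 2" for M m
  proof
    assume "is_cone J C Fo Fa M m"
    then have l: "\<forall>i\<in>Obj J. m i \<in> Hom C M (Fo i)"
      and n: "\<And>i j \<alpha>. \<alpha>\<in>Hom J i j \<Longrightarrow> Fa \<alpha> \<cdot> m i = m j"
      by (auto simp: is_cone_def)
    show "m 0 \<in> Hom C M A \<and> m 1 \<in> Hom C M B \<and>
      m 2 \<in> Hom C M D \<and> f \<cdot> m 0 = m 2 \<and> g \<cdot> m 1 = m 2"
      using l n[of 3 0 2] n[of 4 1 2] by (simp add: J_def Hom_def Fo_def Fa_def)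
  next
    assume *: "m 0 \<in> Hom C M A \<and> m 1 \<in> Hom C M B \<and>
      m 2 \<in> Hom C M D \<and> f \<cdot> m 0 = m 2 \<and> g \<cdot> m 1 = m 2"
    then have "M \<in> Obj C"
      using HomD(4) by blast
    with * show "is_cone J C Fo Fa M m"
      unfolding is_cone_def by (auto simp: J_def Hom_def Fo_def Fa_def split: if_splits)
  qed
  have l: "l 0 \<in> Hom C L A" "l 1 \<in> Hom C L B" "f \<cdot> l 0 = l 2" "g \<cdot> l 1 = l 2"
    using L by (simp_all add: is_limit_def cone)
  note [simp] = HomD[OF l(1)] HomD[OF l(2)]
  have univ: "\<exists>!w. w \<in> Hom C z L \<and> l 0 \<cdot> w = a \<and> l 1 \<cdot> w = b"
    if a: "a \<in> Hom C z A" and b: "b \<in> Hom C z B" and eq: "f \<cdot> a = g \<cdot> b" for z a b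
  proof -
    define m where "m = (\<lambda>i::nat. if i = 0 then a else if i = 1 then b else f \<cdot> a)"
    note [simp] = HomD[OF a] HomD[OF b]
    have "is_cone J C Fo Fa z m"
      unfolding cone using a b eq comp_in_Hom[OF g b] by (simp add: m_def)
    then have ex: "\<exists>!w. w \<in> Hom C z L \<and> (\<forall>i\<in>Obj J. l i \<cdot> w = m i)"
      using L by (simp add: is_limit_def)
    \<comment> \<open>The condition at the vertex \<open>2\<close> follows from the one at
      \<open>0\<close>, because \<open>l 2 = f \<cdot> l 0\<close>.\<close>
    have "(\<forall>i\<in>Obj J. l i \<cdot> w = m i) \<longleftrightarrow> l 0 \<cdot> w = a \<and> l 1 \<cdot> w = b" if w: "w \<in> Hom C z L" for w
    proof -
      note [simp] = HomD[OF w]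
      have "l 2 \<cdot> w = f \<cdot> (l 0 \<cdot> w)"
        by (simp flip: l(3))
      then show ?thesis
        by (auto simp: J_def m_def)
    qed
    with ex show ?thesis
      by (simp cong: conj_cong)
  qed
  have "is_pullback C (l 0) (l 1) f g"
    unfolding is_pullback_def using f g l univ by simp
  then show ?thesis
    using that by blast
qed

lemma equalizer_exists:
  assumes "finitely_complete C" and a: "a \<in> Hom C A B" and b: "b \<in> Hom C A B"
  obtains i E where "i \<in> Hom C E A" and "a \<cdot> i = b \<cdot> i"
    and "\<And>z c. c \<in> Hom C z A \<Longrightarrow> a \<cdot> c = b \<cdot> c \<Longrightarrow> \<exists>!w. w \<in> Hom C z E \<and> i \<cdot> w = c"
proof -
  \<comment> \<open>The parallel pair: \<open>2\<close> and \<open>3\<close> both run from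
    \<open>0\<close> to \<open>1\<close>, and \<open>0\<close>, \<open>1\<close> serve as
    identities.\<close>
  define J :: "(nat, nat) cat" where
    "J = \<lparr>Obj = {0,1}, Arr = {0,1,2,3},
          Dom = (\<lambda>\<alpha>. if \<alpha> = 2 \<or> \<alpha> = 3 then 0 else \<alpha>),
          Cod = (\<lambda>\<alpha>. if \<alpha> = 2 \<or> \<alpha> = 3 then 1 else \<alpha>),
          Ident = (\<lambda>i. i), Comp = (\<lambda>\<beta> \<alpha>. if \<alpha> < 2 then \<beta> else \<alpha>)\<rparr>"
  define Fo where "Fo = (\<lambda>i::nat. if i = 0 then A else B)"
  define Fa where "Fa = (\<lambda>\<alpha>::nat. if \<alpha> = 2 then a else if \<alpha> = 3 then b else Ident C (Fo \<alpha>))"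
  note [simp] = HomD[OF a] HomD[OF b]
  have J: "category J" "finite (Obj J)" "finite (Arr J)"
    by (unfold_locales) (auto simp: J_def Hom_def split: if_splits)
  have F: "is_functor J C Fo Fa"
    unfolding is_functor_def by (auto simp: J_def Hom_def Fo_def Fa_def split: if_splits)
  obtain L l where L: "is_limit J C Fo Fa L l"
    using assms(1) J F unfolding finitely_complete_def by blast
  have cone: "is_cone J C Fo Fa M m \<longleftrightarrow>
      m 0 \<in> Hom C M A \<and> m 1 \<in> Hom C M B \<and> a \<cdot> m 0 = m 1 \<and> b \<cdot> m 0 = m 1" for M m
  proof
    assume "is_cone J C Fo Fa M m"
    then have l: "\<forall>i\<in>Obj J. m i \<in> Hom C M (Fo i)"
      and n: "\<And>i j \<alpha>. \<alpha>\<in>Hom J i j \<Longrightarrow> Fa \<alpha> \<cdot> m i = m j"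
      by (auto simp: is_cone_def)
    show "m 0 \<in> Hom C M A \<and> m 1 \<in> Hom C M B \<and> a \<cdot> m 0 = m 1 \<and> b \<cdot> m 0 = m 1"
      using l n[of 2 0 1] n[of 3 0 1] by (simp add: J_def Hom_def Fo_def Fa_def)
  next
    assume *: "m 0 \<in> Hom C M A \<and> m 1 \<in> Hom C M B \<and> a \<cdot> m 0 = m 1 \<and> b \<cdot> m 0 = m 1"
    then have "M \<in> Obj C"
      using HomD(4) by blast
    with * show "is_cone J C Fo Fa M m"
      unfolding is_cone_def by (auto simp: J_def Hom_def Fo_def Fa_def split: if_splits)
  qed
  have l: "l 0 \<in> Hom C L A" "a \<cdot> l 0 = l 1" "b \<cdot> l 0 = l 1"
    using L by (simp_all add: is_limit_def cone)
  note [simp] = HomD[OF l(1)]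
  have univ: "\<exists>!w. w \<in> Hom C z L \<and> l 0 \<cdot> w = c"
    if c: "c \<in> Hom C z A" and eq: "a \<cdot> c = b \<cdot> c" for z c
  proof -
    define m where "m = (\<lambda>i::nat. if i = 0 then c else a \<cdot> c)"
    note [simp] = HomD[OF c]
    have "is_cone J C Fo Fa z m"
      unfolding cone using c eq comp_in_Hom[OF b c] by (simp add: m_def)
    then have ex: "\<exists>!w. w \<in> Hom C z L \<and> (\<forall>i\<in>Obj J. l i \<cdot> w = m i)"
      using L by (simp add: is_limit_def)
    have "(\<forall>i\<in>Obj J. l i \<cdot> w = m i) \<longleftrightarrow> l 0 \<cdot> w = c" if w: "w \<in> Hom C z L" for w
    proof -
      note [simp] = HomD[OF w]
      have "l 1 \<cdot> w = a \<cdot> (l 0 \<cdot> w)"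
        using comp_assoc[of w "l 0" a] l(2) by simp
      then show ?thesis
        by (auto simp: J_def m_def)
    qed
    with ex show ?thesis
      by (simp cong: conj_cong)
  qed
  show ?thesis
    using that[of "l 0" L] l univ by simp
qed

text \<open>The witnesses of reflexivity, symmetry and transitivity are the factorizations through
  the pullback of the pair of identities, of \<open>(b, a)\<close> and of
  \<open>(a \<cdot> p, b \<cdot> q)\<close>.\<close>

lemma kernel_pair_equivalence_relation:
  assumes "finitely_complete C" and "kernel_pair C a b f"
  shows "equivalence_relation C (Dom C f) a b"
proof -
  have pb: "is_pullback C a b f f"
    using assms(2) by (simp add: kernel_pair_def)
  note D = is_pullbackD[OF pb]
  note [simp] = is_pullback_simps(1-7)[OF pb] Dom_Obj Cod_Obj
  have id: "Ident C (Dom C f) \<in> Hom C (Dom C f) (Dom C f)"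
    by (rule Ident_Hom) simp
  obtain r where r: "r \<in> Hom C (Dom C f) (Dom C a)" "a \<cdot> r = Ident C (Dom C f)"
      "b \<cdot> r = Ident C (Dom C f)"
    by (rule pullback_factor[OF pb id id refl])
  obtain \<sigma> where \<sigma>: "\<sigma> \<in> Hom C (Dom C a) (Dom C a)" "a \<cdot> \<sigma> = b" "b \<cdot> \<sigma> = a"
    by (rule pullback_factor[OF pb D(2,1) D(5)[symmetric]])
  obtain p q where pq: "is_pullback C p q b a"
    by (rule pullback_exists[OF assms(1) D(2,1)])
  note E = is_pullbackD[OF pq]
  note [simp] = is_pullback_simps[OF pq]
  have "f \<cdot> (b \<cdot> p) = f \<cdot> (b \<cdot> q)"
    unfolding E(5) by (simp add: comp_extend[OF D(5)])
  then have "f \<cdot> (a \<cdot> p) = f \<cdot> (b \<cdot> q)"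
    by (simp add: comp_extend[OF D(5)])
  then obtain m where "m \<in> Hom C (Dom C p) (Dom C a)" "a \<cdot> m = a \<cdot> p" "b \<cdot> m = b \<cdot> q"
    by (rule pullback_factor[OF pb, rotated 2]) (simp_all add: Hom_def)
  then show ?thesis
    unfolding equivalence_relation_def
    using D(1,2) r \<sigma> pq pullback_unique[OF pb] by blast
qed

section \<open>Consequences of protomodularity for points\<close>

text \<open>The form in which protomodularity is used: the base change is presented by
  two pullback squares with the same projection.\<close>

lemma protomodular_iso:
  assumes "protomodular C" and dr: "split_epi C d r" and pc: "split_epi C p c"
    and \<theta>: "\<theta> \<in> Hom C (Dom C d) (Dom C p)" "p \<cdot> \<theta> = d" "\<theta> \<cdot> r = c"
    and v: "is_pullback C v e d u" and w: "is_pullback C (\<theta> \<cdot> v) e p u"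
  obtains l where "l \<in> Hom C (Dom C p) (Dom C d)" and "l \<cdot> \<theta> = Ident C (Dom C d)"
    and "\<theta> \<cdot> l = Ident C (Dom C p)"
proof -
  note V = is_pullbackD[OF v]
  note W = is_pullbackD[OF w]
  have d: "d \<in> Hom C (Dom C d) (Cod C d)" and r: "r \<in> Hom C (Cod C d) (Dom C d)"
    and p: "p \<in> Hom C (Dom C p) (Cod C p)" and c: "c \<in> Hom C (Cod C p) (Dom C p)"
    using dr pc by (auto simp: split_epi_def Hom_def)
  have sec: "d \<cdot> r = Ident C (Cod C d)" "p \<cdot> c = Ident C (Cod C p)"
    using dr pc by (auto simp: split_epi_def)
  note [simp] = HomD[OF r] HomD[OF c] HomD[OF \<theta>(1)] HomD(1)[OF p] Dom_Obj
    is_pullback_simps[OF v]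
  have cod: "Cod C p = Cod C d"
    using \<theta>(2) comp_simps(3)[of \<theta> p] by simp
  \<comment> \<open>\<open>\<rho>\<close> is the section of \<open>e\<close> that \<open>r\<close>
    induces by base change along \<open>u\<close>.\<close>
  have "d \<cdot> (r \<cdot> u) = u \<cdot> Ident C (Dom C u)"
    by (simp add: comp_extend[OF sec(1)])
  moreover have "r \<cdot> u \<in> Hom C (Dom C u) (Dom C d)" "Ident C (Dom C u) \<in> Hom C (Dom C u) (Dom C u)"
    by (simp_all add: Hom_def)
  ultimately obtain \<rho> where \<rho>: "\<rho> \<in> Hom C (Dom C u) (Dom C v)" "v \<cdot> \<rho> = r \<cdot> u"
      "e \<cdot> \<rho> = Ident C (Dom C u)"
    using pullback_factor[OF v] by metis
  note [simp] = HomD[OF \<rho>(1)]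
  have er: "split_epi C e \<rho>"
    using \<rho> by (simp add: split_epi_def)
  have "fibre_mor C d r p c \<theta>"
    using dr pc \<theta> cod by (simp add: fibre_mor_def point_mor_def Hom_def)
  moreover have id: "fibre_mor C e \<rho> e \<rho> (Ident C (Dom C e))"
    using er by (simp add: fibre_mor_def point_mor_def Hom_def)
  moreover have "cartesian_mor C e \<rho> d r u v"
    using dr er V \<rho> v by (simp add: cartesian_mor_def point_mor_def Hom_def)
  moreover have "cartesian_mor C e \<rho> p c u (\<theta> \<cdot> v)"
    using pc er V W \<rho> w cod \<theta>
    by (simp add: cartesian_mor_def point_mor_def Hom_def comp_extend[OF \<theta>(3)])
  moreover have "(\<theta> \<cdot> v) \<cdot> Ident C (Dom C e) = \<theta> \<cdot> v"
    by simp
  \<comment> \<open>Both points restrict along \<open>u\<close> to \<open>(e, \<rho>)\<close>, with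
    projections \<open>v\<close> and \<open>\<theta> \<cdot> v\<close>, so the base change of
    \<open>\<theta>\<close> is an identity and \<open>\<theta>\<close> is itself invertible.\<close>
  ultimately have "base_change C u d r p c \<theta> e \<rho> e \<rho> (Ident C (Dom C e))"
    unfolding base_change_def by blast
  moreover have "fibre_iso C e \<rho> e \<rho> (Ident C (Dom C e))"
    unfolding fibre_iso_def using id by (intro conjI exI[of _ "Ident C (Dom C e)"]) auto
  ultimately have "fibre_iso C d r p c \<theta>"
    using assms(1) unfolding protomodular_def by blast
  then show ?thesis
    using that by (auto simp: fibre_iso_def fibre_mor_def point_mor_def)
qed

text \<open>Both \<open>r\<close> and \<open>v\<close> factor through the equalizer \<open>i\<close>
  of \<open>a\<close> and \<open>b\<close>, so \<open>d \<cdot> i\<close> is a split epimorphism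
  with the same pullback along \<open>u\<close> as \<open>d\<close>. Protomodularity makes
  \<open>i\<close> invertible, which forces \<open>a = b\<close>.\<close>

lemma protomodular_jointly_epic:
  assumes "protomodular C" and dr: "split_epi C d r" and v: "is_pullback C v e d u"
    and a: "a \<in> Hom C (Dom C d) B" and b: "b \<in> Hom C (Dom C d) B"
    and abv: "a \<cdot> v = b \<cdot> v" and abr: "a \<cdot> r = b \<cdot> r"
  shows "a = b"
proof -
  have fc: "finitely_complete C"
    using assms(1) by (simp add: protomodular_def)
  note V = is_pullbackD[OF v]
  have r: "r \<in> Hom C (Cod C d) (Dom C d)" and sec: "d \<cdot> r = Ident C (Cod C d)"
    using dr by (auto simp: split_epi_def)
  note [simp] = is_pullback_simps[OF v] HomD[OF r]
    HomD[OF a] HomD[OF b]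
  obtain i E where i: "i \<in> Hom C E (Dom C d)" "a \<cdot> i = b \<cdot> i"
    and univ: "\<And>z c. c \<in> Hom C z (Dom C d) \<Longrightarrow> a \<cdot> c = b \<cdot> c \<Longrightarrow> \<exists>!w. w \<in> Hom C z E \<and> i \<cdot> w = c"
    using equalizer_exists[OF fc a b] by blast
  note [simp] = HomD[OF i(1)]
  obtain r' where r': "r' \<in> Hom C (Cod C d) E" "i \<cdot> r' = r"
    using univ[OF r abr] by blast
  obtain v' where v': "v' \<in> Hom C (Dom C v) E" "i \<cdot> v' = v"
    using univ[OF V(1) abv] by blast
  note [simp] = HomD[OF r'(1)] HomD[OF v'(1)]
  have imono: "w = w'" if "w \<in> Hom C z E" "w' \<in> Hom C z E" "i \<cdot> w = i \<cdot> w'" for w w' z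
  proof -
    note [simp] = HomD[OF that(1)]
    have "i \<cdot> w \<in> Hom C z (Dom C d)" "a \<cdot> (i \<cdot> w) = b \<cdot> (i \<cdot> w)"
      by (simp_all add: Hom_def comp_extend[OF i(2)])
    with univ that show ?thesis
      by metis
  qed
  have "split_epi C (d \<cdot> i) r'"
    using r' sec by (simp add: split_epi_def)
  \<comment> \<open>An \<open>x\<close> into \<open>E\<close> and a \<open>y\<close> that match over
    \<open>u\<close> factor through \<open>v\<close>; the factorization also yields \<open>x\<close>
    after \<open>v'\<close>, because \<open>i\<close> is monic.\<close>
  moreover have "is_pullback C v' e (d \<cdot> i) u"
  proof (rule is_pullbackI)
    show "v' \<in> Hom C (Dom C v) E" "e \<in> Hom C (Dom C v) (Dom C u)"
      "d \<cdot> i \<in> Hom C E (Cod C d)" "u \<in> Hom C (Dom C u) (Cod C d)"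
      by (simp_all add: Hom_def)
    show "(d \<cdot> i) \<cdot> v' = u \<cdot> e"
      using v' V(5) by simp
  next
    fix z x y
    assume x: "x \<in> Hom C z E" and y: "y \<in> Hom C z (Dom C u)" and eq: "(d \<cdot> i) \<cdot> x = u \<cdot> y"
    note [simp] = HomD[OF x] HomD[OF y]
    have "i \<cdot> x \<in> Hom C z (Dom C d)" "d \<cdot> (i \<cdot> x) = u \<cdot> y"
      using eq by (simp_all add: Hom_def)
    then obtain w where w: "w \<in> Hom C z (Dom C v)" "v \<cdot> w = i \<cdot> x" "e \<cdot> w = y"
      using pullback_factor[OF v _ y] by blast
    note [simp] = HomD[OF w(1)]
    have "v' \<cdot> w = x"
      by (rule imono[OF _ x]) (simp_all add: Hom_def comp_extend[OF v'(2)] w)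
    with w show "\<exists>w\<in>Hom C z (Dom C v). v' \<cdot> w = x \<and> e \<cdot> w = y"
      by blast
  next
    fix z w w'
    assume w: "w \<in> Hom C z (Dom C v)" "w' \<in> Hom C z (Dom C v)"
      and eq: "v' \<cdot> w = v' \<cdot> w'" "e \<cdot> w = e \<cdot> w'"
    note [simp] = HomD[OF w(1)] HomD[OF w(2)]
    have "v \<cdot> w = v \<cdot> w'"
      using comp_extend[OF v'(2), of w] comp_extend[OF v'(2), of w'] eq by simp
    then show "w = w'"
      using pullback_unique[OF v w] eq by blast
  qed
  moreover have "is_pullback C (i \<cdot> v') e d u"
    using v v'(2) by simp
  moreover have "i \<in> Hom C (Dom C (d \<cdot> i)) (Dom C d)"
    using i by simp
  ultimately obtain l where l: "l \<in> Hom C (Dom C d) (Dom C (d \<cdot> i))" "i \<cdot> l = Ident C (Dom C d)"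
    using protomodular_iso[OF assms(1) _ dr, of "d \<cdot> i" r' i v' e u] r' by metis
  note [simp] = HomD(1-3)[OF l(1)]
  have "a \<cdot> (i \<cdot> l) = b \<cdot> (i \<cdot> l)"
    by (simp add: comp_extend[OF i(2)])
  then show ?thesis
    by (simp add: l(2))
qed

section \<open>Kernel pairs, their quotients and inverse images\<close>

lemma kernel_pairD:
  assumes "kernel_pair C a b f"
  shows "a \<in> Arr C" and "b \<in> Arr C" and "f \<in> Arr C"
    and "Cod C a = Dom C f" and "Dom C b = Dom C a" and "Cod C b = Dom C f"
    and "f \<cdot> a = f \<cdot> b"
  using assms is_pullback_simps[of a b f f] is_pullbackD(5)[of a b f f]
  by (simp_all add: kernel_pair_def)

lemma kernel_pair_factor:
  assumes "kernel_pair C a b f" and "x \<in> Hom C z (Dom C f)" and "y \<in> Hom C z (Dom C f)"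
    and "f \<cdot> x = f \<cdot> y"
  obtains w where "w \<in> Hom C z (Dom C a)" and "a \<cdot> w = x" and "b \<cdot> w = y"
  using assms by (auto simp: kernel_pair_def elim: pullback_factor)

lemma kernel_pair_unique:
  assumes "kernel_pair C a b f" and "w \<in> Hom C z (Dom C a)" and "w' \<in> Hom C z (Dom C a)"
    and "a \<cdot> w = a \<cdot> w'" and "b \<cdot> w = b \<cdot> w'"
  shows "w = w'"
  using assms pullback_unique by (auto simp: kernel_pair_def)

lemma kernel_pairI:
  assumes "a \<in> Hom C R A" and "b \<in> Hom C R A" and "f \<in> Hom C A B" and "f \<cdot> a = f \<cdot> b"
    and "\<And>z x y. x \<in> Hom C z A \<Longrightarrow> y \<in> Hom C z A \<Longrightarrow> f \<cdot> x = f \<cdot> y \<Longrightarrow>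
      \<exists>w\<in>Hom C z R. a \<cdot> w = x \<and> b \<cdot> w = y"
    and "\<And>z w w'. w \<in> Hom C z R \<Longrightarrow> w' \<in> Hom C z R \<Longrightarrow> a \<cdot> w = a \<cdot> w' \<Longrightarrow> b \<cdot> w = b \<cdot> w' \<Longrightarrow> w = w'"
  shows "kernel_pair C a b f"
  unfolding kernel_pair_def using assms by (intro is_pullbackI[of a R A b A f B f]) blast+

lemma kernel_pair_comp_monic:
  assumes ab: "kernel_pair C a b f" and m: "monic C m" and [simp]: "Dom C m = Cod C f"
  shows "kernel_pair C a b (m \<cdot> f)"
proof -
  note [simp] = kernel_pairD(1-6)[OF ab]
  have [simp]: "m \<in> Arr C"
    using m by (simp add: monic_def)
  show ?thesis
  proof (rule kernel_pairI)
    fix z x y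
    assume x: "x \<in> Hom C z (Dom C f)" and y: "y \<in> Hom C z (Dom C f)"
      and eq: "(m \<cdot> f) \<cdot> x = (m \<cdot> f) \<cdot> y"
    note [simp] = HomD[OF x] HomD[OF y]
    have "m \<cdot> (f \<cdot> x) = m \<cdot> (f \<cdot> y)"
      using eq by simp
    then have "f \<cdot> x = f \<cdot> y"
      using m by (simp add: monic_def Hom_def)
    then show "\<exists>w\<in>Hom C z (Dom C a). a \<cdot> w = x \<and> b \<cdot> w = y"
      using kernel_pair_factor[OF ab x y] by blast
  next
    show "(m \<cdot> f) \<cdot> a = (m \<cdot> f) \<cdot> b"
      by (simp add: kernel_pairD(7)[OF ab])
  qed (use kernel_pair_unique[OF ab] in \<open>auto simp: Hom_def\<close>)
qed

text \<open>\<open>f\<close> factors through the quotient \<open>q\<close>, so arrows identified by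
  \<open>q\<close> are identified by \<open>f\<close> and hence related by its kernel pair.\<close>

lemma kernel_pair_coequalizer:
  assumes ab: "kernel_pair C a b f" and q: "is_coequalizer C q a b"
  shows "kernel_pair C a b q"
proof -
  note [simp] = kernel_pairD(1-6)[OF ab] coequalizerD(1)[OF q]
  have [simp]: "Dom C q = Dom C f"
    using HomD(3)[OF coequalizerD(2)[OF q]] by simp
  obtain w where w: "w \<in> Hom C (Cod C q) (Cod C f)" "w \<cdot> q = f"
    by (rule coequalizer_factor[OF q _ kernel_pairD(7)[OF ab]]) (simp add: Hom_def)
  note [simp] = HomD[OF w(1)]
  show ?thesis
  proof (rule kernel_pairI)
    fix z x y
    assume x: "x \<in> Hom C z (Dom C f)" and y: "y \<in> Hom C z (Dom C f)" and eq: "q \<cdot> x = q \<cdot> y"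
    note [simp] = HomD[OF x] HomD[OF y]
    have "w \<cdot> (q \<cdot> x) = w \<cdot> (q \<cdot> y)"
      using eq by simp
    then have "f \<cdot> x = f \<cdot> y"
      by (simp add: comp_extend[OF w(2)])
    then show "\<exists>w\<in>Hom C z (Dom C a). a \<cdot> w = x \<and> b \<cdot> w = y"
      using kernel_pair_factor[OF ab x y] by blast
  qed (use kernel_pair_unique[OF ab] coequalizerD(4)[OF q] in \<open>auto simp: Hom_def\<close>)
qed

lemma inverse_imageD:
  assumes "inverse_image C u d\<^sub>0 d\<^sub>1 e\<^sub>0 e\<^sub>1 v"
  shows "u \<in> Arr C" and "d\<^sub>0 \<in> Arr C" and "d\<^sub>1 \<in> Arr C" and "e\<^sub>0 \<in> Arr C" and "e\<^sub>1 \<in> Arr C" and "v \<in> Arr C"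
    and "Dom C d\<^sub>1 = Dom C d\<^sub>0" and "Cod C d\<^sub>0 = Cod C u" and "Cod C d\<^sub>1 = Cod C u"
    and "Dom C e\<^sub>1 = Dom C e\<^sub>0" and "Cod C e\<^sub>0 = Dom C u" and "Cod C e\<^sub>1 = Dom C u"
    and "Dom C v = Dom C e\<^sub>0" and "Cod C v = Dom C d\<^sub>0"
    and "d\<^sub>0 \<cdot> v = u \<cdot> e\<^sub>0" and "d\<^sub>1 \<cdot> v = u \<cdot> e\<^sub>1"
  using assms by (auto simp: inverse_image_def Hom_def)

lemma inverse_image_ex1:
  assumes "inverse_image C u d\<^sub>0 d\<^sub>1 e\<^sub>0 e\<^sub>1 v"
    and "a \<in> Hom C z (Dom C u)" and "b \<in> Hom C z (Dom C u)" and "c \<in> Hom C z (Dom C d\<^sub>0)"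
    and "d\<^sub>0 \<cdot> c = u \<cdot> a" and "d\<^sub>1 \<cdot> c = u \<cdot> b"
  shows "\<exists>!w. w \<in> Hom C z (Dom C e\<^sub>0) \<and> e\<^sub>0 \<cdot> w = a \<and> e\<^sub>1 \<cdot> w = b \<and> v \<cdot> w = c"
  using assms unfolding inverse_image_def by blast

text \<open>A pair \<open>(x, y)\<close> is identified by \<open>q \<cdot> u\<close> exactly when
  \<open>(u \<cdot> x, u \<cdot> y)\<close> factors through the kernel pair of \<open>q\<close>.
  This makes the inverse image effective as soon as the relation is.\<close>

lemma inverse_image_kernel_pair:
  assumes inv: "inverse_image C u d\<^sub>0 d\<^sub>1 e\<^sub>0 e\<^sub>1 v" and d: "kernel_pair C d\<^sub>0 d\<^sub>1 q"
  shows "kernel_pair C e\<^sub>0 e\<^sub>1 (q \<cdot> u)"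
proof -
  note I = inverse_imageD[OF inv]
  note [simp] = I(1-7,10-14) kernel_pairD(1-6)[OF d]
  have qu: "Cod C u = Dom C q"
    using I(8) by simp
  note [simp] = qu
  note ext = comp_extend[OF I(15)] comp_extend[OF I(16)]
  show ?thesis
  proof (rule kernel_pairI)
    have "q \<cdot> (d\<^sub>0 \<cdot> v) = q \<cdot> (d\<^sub>1 \<cdot> v)"
      by (simp add: comp_extend[OF kernel_pairD(7)[OF d]])
    then show "(q \<cdot> u) \<cdot> e\<^sub>0 = (q \<cdot> u) \<cdot> e\<^sub>1"
      by (simp add: I(15,16))
  next
    fix z x y
    assume x: "x \<in> Hom C z (Dom C u)" and y: "y \<in> Hom C z (Dom C u)"
      and eq: "(q \<cdot> u) \<cdot> x = (q \<cdot> u) \<cdot> y"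
    note [simp] = HomD[OF x] HomD[OF y]
    obtain c where c: "c \<in> Hom C z (Dom C d\<^sub>0)" "d\<^sub>0 \<cdot> c = u \<cdot> x" "d\<^sub>1 \<cdot> c = u \<cdot> y"
      by (rule kernel_pair_factor[OF d, of "u \<cdot> x" z "u \<cdot> y"]) (use eq in \<open>simp_all add: Hom_def\<close>)
    show "\<exists>w\<in>Hom C z (Dom C e\<^sub>0). e\<^sub>0 \<cdot> w = x \<and> e\<^sub>1 \<cdot> w = y"
      using inverse_image_ex1[OF inv x y c] by blast
  next
    fix z w w'
    assume w: "w \<in> Hom C z (Dom C e\<^sub>0)" "w' \<in> Hom C z (Dom C e\<^sub>0)"
      and eq: "e\<^sub>0 \<cdot> w = e\<^sub>0 \<cdot> w'" "e\<^sub>1 \<cdot> w = e\<^sub>1 \<cdot> w'"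
    note [simp] = HomD[OF w(1)] HomD[OF w(2)]
    \<comment> \<open>Uniqueness for an inverse image also compares the composites with
      \<open>v\<close>; these are determined by the other two, since \<open>d\<^sub>0\<close> and
      \<open>d\<^sub>1\<close> are jointly monic.\<close>
    have vw: "v \<cdot> w = v \<cdot> w'"
      by (rule kernel_pair_unique[OF d, of _ z]) (simp_all add: Hom_def ext eq)
    have "\<exists>!x. x \<in> Hom C z (Dom C e\<^sub>0) \<and> e\<^sub>0 \<cdot> x = e\<^sub>0 \<cdot> w \<and> e\<^sub>1 \<cdot> x = e\<^sub>1 \<cdot> w \<and> v \<cdot> x = v \<cdot> w"
      by (rule inverse_image_ex1[OF inv]) (simp_all add: Hom_def ext)
    then show "w = w'"
      using w eq vw by metis
  qed (simp_all add: Hom_def)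
qed

text \<open>The converse direction, for competing decompositions: there the relation on the base
  comes as a kernel pair and has to be recognized as an inverse image. The arrow \<open>v\<close> is
  induced by the kernel pair of \<open>q\<close>.\<close>

lemma kernel_pair_inverse_image:
  assumes e: "kernel_pair C e\<^sub>0 e\<^sub>1 (q \<cdot> u)" and d: "kernel_pair C d\<^sub>0 d\<^sub>1 q"
    and u: "u \<in> Arr C" "Cod C u = Dom C q"
  obtains v where "inverse_image C u d\<^sub>0 d\<^sub>1 e\<^sub>0 e\<^sub>1 v"
proof -
  note [simp] = u kernel_pairD(1-6)[OF d]
  note [simp] = kernel_pairD(1-6)[OF e, simplified]
  note e' = e[THEN kernel_pairD(7), simplified]
  obtain v where v: "v \<in> Hom C (Dom C e\<^sub>0) (Dom C d\<^sub>0)" "d\<^sub>0 \<cdot> v = u \<cdot> e\<^sub>0" "d\<^sub>1 \<cdot> v = u \<cdot> e\<^sub>1"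
    by (rule kernel_pair_factor[OF d, of "u \<cdot> e\<^sub>0" "Dom C e\<^sub>0" "u \<cdot> e\<^sub>1"])
      (simp_all add: Hom_def e')
  note [simp] = HomD[OF v(1)]
  have "\<exists>!w. w \<in> Hom C z (Dom C e\<^sub>0) \<and> e\<^sub>0 \<cdot> w = a \<and> e\<^sub>1 \<cdot> w = b \<and> v \<cdot> w = c"
    if a: "a \<in> Hom C z (Dom C u)" and b: "b \<in> Hom C z (Dom C u)" and c: "c \<in> Hom C z (Dom C d\<^sub>0)"
      and eq: "d\<^sub>0 \<cdot> c = u \<cdot> a" "d\<^sub>1 \<cdot> c = u \<cdot> b" for z a b c
  proof -
    note [simp] = HomD[OF a] HomD[OF b] HomD[OF c]
    have "q \<cdot> (d\<^sub>0 \<cdot> c) = q \<cdot> (d\<^sub>1 \<cdot> c)"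
      by (simp add: comp_extend[OF kernel_pairD(7)[OF d]])
    then have eq': "(q \<cdot> u) \<cdot> a = (q \<cdot> u) \<cdot> b"
      by (simp add: eq)
    obtain w where w: "w \<in> Hom C z (Dom C e\<^sub>0)" "e\<^sub>0 \<cdot> w = a" "e\<^sub>1 \<cdot> w = b"
      by (rule kernel_pair_factor[OF e _ _ eq']) (simp_all add: Hom_def)
    note [simp] = HomD[OF w(1)]
    have "v \<cdot> w = c"
      by (rule kernel_pair_unique[OF d, of _ z])
        (simp_all add: Hom_def comp_extend[OF v(2)] comp_extend[OF v(3)] eq w)
    with w show ?thesis
      using kernel_pair_unique[OF e] by (metis (no_types))
  qed
  then have "inverse_image C u d\<^sub>0 d\<^sub>1 e\<^sub>0 e\<^sub>1 v"
    unfolding inverse_image_def using v by (auto simp: Hom_def)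
  then show ?thesis
    by (rule that)
qed

section \<open>Pullback squares from discrete fibrations of kernel pairs\<close>

text \<open>The Barr-Kock theorem. The comparison \<open>n\<close> from \<open>X\<close> to the pullback is monic because the
  relation above \<open>f\<close> restricts to the diagonal on the kernel pair of \<open>f\<close>, and \<open>n \<cdot> d\<^sub>1\<close> is a
  regular epimorphism because it is a pullback of \<open>q\<close>; hence \<open>n\<close> is invertible.\<close>

lemma barr_kock:
  assumes reg: "regular_category C" and q: "regular_epi C q" and qT: "kernel_pair C d\<^sub>0 d\<^sub>1 q"
    and hS: "kernel_pair C e\<^sub>0 e\<^sub>1 h"
    and f: "f \<in> Hom C (Dom C q) (Dom C h)" and fb: "fb \<in> Hom C (Cod C q) (Cod C h)"
    and sq: "fb \<cdot> q = h \<cdot> f"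
    and \<phi>: "is_pullback C d\<^sub>0 \<phi> f e\<^sub>0" "e\<^sub>1 \<cdot> \<phi> = f \<cdot> d\<^sub>1"
  shows "is_pullback C q f fb h"
proof -
  have fc: "finitely_complete C"
    using reg by (simp add: regular_category_def)
  note [simp] = kernel_pairD(1-6)[OF qT] kernel_pairD(1-6)[OF hS] HomD(1-3)[OF f] HomD(1-3)[OF fb]
    is_pullback_simps(2,6,7)[OF \<phi>(1)]
  note T = kernel_pairD(7)[OF qT] and S = kernel_pairD(7)[OF hS]
  note \<phi>0 = is_pullbackD(5)[OF \<phi>(1), symmetric]
  obtain p y where py: "is_pullback C p y fb h"
    by (rule pullback_exists[OF fc fb, of h "Dom C h"]) (auto simp: Hom_def)
  note [simp] = is_pullback_simps(1,2,5-7)[OF py, simplified]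
  note py' = is_pullbackD(5)[OF py]
  obtain n where n: "n \<in> Hom C (Dom C q) (Dom C p)" "p \<cdot> n = q" "y \<cdot> n = f"
    by (rule pullback_factor[OF py _ _ sq]) (simp_all add: Hom_def)
  note [simp] = HomD(1-3)[OF n(1)]
  obtain r where r: "r \<in> Hom C (Dom C q) (Dom C d\<^sub>0)"
    "d\<^sub>0 \<cdot> r = Ident C (Dom C q)" "d\<^sub>1 \<cdot> r = Ident C (Dom C q)"
    using kernel_pair_equivalence_relation[OF fc qT] by (auto simp: equivalence_relation_def)
  note [simp] = HomD(1-3)[OF r(1)]
  have mono: "w = w'" if w: "w \<in> Hom C z (Dom C q)" "w' \<in> Hom C z (Dom C q)"
    and eq: "q \<cdot> w = q \<cdot> w'" "f \<cdot> w = f \<cdot> w'" for w w' z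
  proof -
    note [simp] = HomD[OF w(1)] HomD[OF w(2)]
    obtain \<tau> where \<tau>: "\<tau> \<in> Hom C z (Dom C d\<^sub>0)" "d\<^sub>0 \<cdot> \<tau> = w" "d\<^sub>1 \<cdot> \<tau> = w'"
      by (rule kernel_pair_factor[OF qT w eq(1)])
    note [simp] = HomD[OF \<tau>(1)]
    \<comment> \<open>\<open>\<tau>\<close> and \<open>r \<cdot> w\<close> both start at
      \<open>w\<close>, and both lie over the same diagonal pair because
      \<open>f \<cdot> w = f \<cdot> w'\<close>; the pullback property of \<open>d\<^sub>0\<close>,
      \<open>\<phi>\<close> then identifies them.\<close>
    have "\<phi> \<cdot> \<tau> = \<phi> \<cdot> (r \<cdot> w)"
      by (rule kernel_pair_unique[OF hS, of _ z])
        (simp_all add: Hom_def comp_extend[OF \<phi>0] comp_extend[OF \<phi>(2)] \<tau> eq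
          comp_extend[OF r(2)] comp_extend[OF r(3)])
    then have "\<tau> = r \<cdot> w"
      by - (rule pullback_unique[OF \<phi>(1), of _ z],
        simp_all add: Hom_def \<tau> comp_extend[OF r(2)])
    then have "d\<^sub>1 \<cdot> (r \<cdot> w) = w'"
      using \<tau>(3) by simp
    then show ?thesis
      by (simp add: comp_extend[OF r(3)])
  qed
  have nmono: "w = w'" if w: "w \<in> Hom C z (Dom C q)" "w' \<in> Hom C z (Dom C q)"
    and eq: "n \<cdot> w = n \<cdot> w'" for w w' z
  proof (rule mono[OF w])
    note [simp] = HomD[OF w(1)] HomD[OF w(2)]
    show "q \<cdot> w = q \<cdot> w'" "f \<cdot> w = f \<cdot> w'"
      using comp_extend[OF n(2), of w] comp_extend[OF n(2), of w']
        comp_extend[OF n(3), of w] comp_extend[OF n(3), of w'] eq by simp_all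
  qed
  have "is_pullback C (n \<cdot> d\<^sub>1) d\<^sub>0 p q"
  proof (rule is_pullbackI)
    show "n \<cdot> d\<^sub>1 \<in> Hom C (Dom C d\<^sub>0) (Dom C p)" "d\<^sub>0 \<in> Hom C (Dom C d\<^sub>0) (Dom C q)"
      "p \<in> Hom C (Dom C p) (Cod C q)" "q \<in> Hom C (Dom C q) (Cod C q)"
      by (simp_all add: Hom_def)
    show "p \<cdot> (n \<cdot> d\<^sub>1) = q \<cdot> d\<^sub>0"
      by (simp add: comp_extend[OF n(2)] T)
  next
    fix z a b
    assume a: "a \<in> Hom C z (Dom C p)" and b: "b \<in> Hom C z (Dom C q)" and eq: "p \<cdot> a = q \<cdot> b"
    note [simp] = HomD[OF a] HomD[OF b]
    have "fb \<cdot> (p \<cdot> a) = fb \<cdot> (q \<cdot> b)"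
      using eq by simp
    \<comment> \<open>The pair \<open>(f \<cdot> b, y \<cdot> a)\<close> lies in the kernel pair of
      \<open>h\<close>; the discrete fibration lifts it to \<open>\<tau>\<close> starting at
      \<open>b\<close>, and \<open>n\<close> sends the end of \<open>\<tau>\<close> to
      \<open>a\<close>.\<close>
    then have "h \<cdot> (f \<cdot> b) = h \<cdot> (y \<cdot> a)"
      by (simp add: comp_extend[OF py'] comp_extend[OF sq])
    then obtain \<sigma> where \<sigma>: "\<sigma> \<in> Hom C z (Dom C e\<^sub>0)" "e\<^sub>0 \<cdot> \<sigma> = f \<cdot> b" "e\<^sub>1 \<cdot> \<sigma> = y \<cdot> a"
      using kernel_pair_factor[OF hS, of "f \<cdot> b" z "y \<cdot> a"] by (auto simp: Hom_def)
    obtain \<tau> where \<tau>: "\<tau> \<in> Hom C z (Dom C d\<^sub>0)" "d\<^sub>0 \<cdot> \<tau> = b" "\<phi> \<cdot> \<tau> = \<sigma>"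
      by (rule pullback_factor[OF \<phi>(1), of b z \<sigma>]) (use b \<sigma> in simp_all)
    note [simp] = HomD[OF \<tau>(1)]
    have "q \<cdot> (d\<^sub>1 \<cdot> \<tau>) = q \<cdot> (d\<^sub>0 \<cdot> \<tau>)"
      by (simp add: comp_extend[OF T])
    moreover have "f \<cdot> (d\<^sub>1 \<cdot> \<tau>) = e\<^sub>1 \<cdot> (\<phi> \<cdot> \<tau>)"
      by (simp add: comp_extend[OF \<phi>(2)])
    ultimately have "n \<cdot> (d\<^sub>1 \<cdot> \<tau>) = a"
      by - (rule pullback_unique[OF py, of _ z],
        simp_all add: Hom_def comp_extend[OF n(2)] comp_extend[OF n(3)] \<sigma> \<tau> eq)
    with \<tau> show "\<exists>w\<in>Hom C z (Dom C d\<^sub>0). (n \<cdot> d\<^sub>1) \<cdot> w = a \<and> d\<^sub>0 \<cdot> w = b"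
      by (intro bexI[of _ \<tau>]) simp_all
  next
    fix z w w'
    assume w: "w \<in> Hom C z (Dom C d\<^sub>0)" "w' \<in> Hom C z (Dom C d\<^sub>0)"
      and eq: "(n \<cdot> d\<^sub>1) \<cdot> w = (n \<cdot> d\<^sub>1) \<cdot> w'" "d\<^sub>0 \<cdot> w = d\<^sub>0 \<cdot> w'"
    note [simp] = HomD[OF w(1)] HomD[OF w(2)]
    have "d\<^sub>1 \<cdot> w = d\<^sub>1 \<cdot> w'"
      by (rule nmono[of _ z]) (use eq in \<open>simp_all add: Hom_def\<close>)
    then show "w = w'"
      using kernel_pair_unique[OF qT w] eq by blast
  qed
  then have nd: "regular_epi C (n \<cdot> d\<^sub>1)"
    using reg q unfolding regular_category_def by blast
  then obtain c\<^sub>0 c\<^sub>1 where c: "is_coequalizer C (n \<cdot> d\<^sub>1) c\<^sub>0 c\<^sub>1"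
    by (auto simp: regular_epi_def)
  note c' = coequalizerD(2,3)[OF c]
  have [simp]: "c\<^sub>0 \<in> Arr C" "c\<^sub>1 \<in> Arr C" "Cod C c\<^sub>0 = Dom C d\<^sub>0" "Cod C c\<^sub>1 = Dom C d\<^sub>0"
    "Dom C c\<^sub>1 = Dom C c\<^sub>0"
    using c' by (simp_all add: Hom_def)
  \<comment> \<open>Since \<open>n\<close> is monic, \<open>d\<^sub>1\<close> coequalizes the pair
    presenting \<open>n \<cdot> d\<^sub>1\<close> and so factors through it by some
    \<open>w\<close>. Cancelling \<open>n \<cdot> d\<^sub>1\<close> makes \<open>w\<close> a section
    of \<open>n\<close>.\<close>
  have "d\<^sub>1 \<cdot> c\<^sub>0 = d\<^sub>1 \<cdot> c\<^sub>1"
    by (rule nmono[of _ "Dom C c\<^sub>0"]) (use coequalizerD(4)[OF c] in \<open>simp_all add: Hom_def\<close>)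
  then obtain w where w: "w \<in> Hom C (Cod C (n \<cdot> d\<^sub>1)) (Dom C q)" "w \<cdot> (n \<cdot> d\<^sub>1) = d\<^sub>1"
    using coequalizer_factor[OF c, of d\<^sub>1 "Dom C q"] by (auto simp: Hom_def)
  have [simp]: "w \<in> Arr C" "Dom C w = Dom C p" "Cod C w = Dom C q"
    using w(1) by (simp_all add: Hom_def)
  have nw: "n \<cdot> w = Ident C (Dom C p)"
    by (rule regular_epi_cancel[OF nd, of _ "Dom C p"]) (simp_all add: Hom_def w(2) Dom_Obj)
  show ?thesis
  proof (rule is_pullbackI)
    fix z a b
    assume ab: "a \<in> Hom C z (Cod C q)" "b \<in> Hom C z (Dom C h)" and eq: "fb \<cdot> a = h \<cdot> b"
    obtain x where x: "x \<in> Hom C z (Dom C p)" "p \<cdot> x = a" "y \<cdot> x = b"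
      by (rule pullback_factor[OF py _ _ eq]) (use ab in simp_all)
    note [simp] = HomD[OF x(1)]
    have "q \<cdot> (w \<cdot> x) = p \<cdot> (n \<cdot> (w \<cdot> x))" "f \<cdot> (w \<cdot> x) = y \<cdot> (n \<cdot> (w \<cdot> x))"
      by (simp_all add: comp_extend[OF n(2)] comp_extend[OF n(3)])
    then have "q \<cdot> (w \<cdot> x) = a" "f \<cdot> (w \<cdot> x) = b"
      by (simp_all add: comp_extend[OF nw] x)
    then show "\<exists>w\<in>Hom C z (Dom C q). q \<cdot> w = a \<and> f \<cdot> w = b"
      by (intro bexI[of _ "w \<cdot> x"]) (simp_all add: Hom_def)
  qed (use f fb sq mono in \<open>auto simp: Hom_def\<close>)
qed

section \<open>Split epimorphisms and discrete fibrations\<close>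

lemma split_epiD:
  assumes "split_epi C f s"
  shows "f \<in> Arr C" and "s \<in> Arr C" and "Dom C s = Cod C f" and "Cod C s = Dom C f"
    and "f \<cdot> s = Ident C (Cod C f)"
  using assms by (auto simp: split_epi_def Hom_def)

lemma split_epi_monic:
  assumes "split_epi C f s"
  shows "monic C s"
  unfolding monic_def
proof (intro conjI allI ballI impI)
  note [simp] = split_epiD(1-4)[OF assms]
  show "s \<in> Arr C"
    by simp
  fix z a b
  assume a: "a \<in> Hom C z (Dom C s)" and b: "b \<in> Hom C z (Dom C s)" and eq: "s \<cdot> a = s \<cdot> b"
  note [simp] = HomD[OF a] HomD[OF b]
  have "f \<cdot> (s \<cdot> a) = a" "f \<cdot> (s \<cdot> b) = b"
    by (simp_all add: comp_extend[OF split_epiD(5)[OF assms]])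
  then show "a = b"
    using eq by metis
qed

lemma point_morD:
  assumes "point_mor C f s g t h k"
  shows "f \<in> Arr C" and "s \<in> Arr C" and "g \<in> Arr C" and "t \<in> Arr C" and "h \<in> Arr C" and "k \<in> Arr C"
    and "Dom C s = Cod C f" and "Cod C s = Dom C f" and "Dom C t = Cod C g" and "Cod C t = Dom C g"
    and "Dom C h = Cod C f" and "Cod C h = Cod C g" and "Dom C k = Dom C f" and "Cod C k = Dom C g"
    and "f \<cdot> s = Ident C (Cod C f)" and "g \<cdot> t = Ident C (Cod C g)"
    and "g \<cdot> k = h \<cdot> f" and "k \<cdot> s = t \<cdot> h"
  using assms by (auto simp: point_mor_def split_epi_def Hom_def)

text \<open>The comparison \<open>\<theta>\<close> from \<open>d\<close> to the pullback
  \<open>p\<close> of \<open>e\<close> along \<open>f\<close> is a morphism of points over the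
  domain of \<open>f\<close>. Along \<open>s\<close> both restrict to \<open>e\<close>, so
  protomodularity inverts \<open>\<theta>\<close>.\<close>

lemma protomodular_discrete_fibration:
  assumes "protomodular C" and fs: "split_epi C f s" and dr: "split_epi C d r"
    and v: "is_pullback C v e d s" and \<phi>: "\<phi> \<in> Hom C (Dom C d) (Dom C e)" "e \<cdot> \<phi> = f \<cdot> d"
    and \<phi>v: "\<phi> \<cdot> v = Ident C (Dom C e)"
  shows "is_pullback C d \<phi> f e"
proof -
  have fc: "finitely_complete C"
    using assms(1) by (simp add: protomodular_def)
  have dX: "Cod C d = Dom C f"
    using is_pullback_simps(8)[OF v] split_epiD(4)[OF fs] by simp
  note [simp] = split_epiD(1-4)[OF fs] split_epiD(1-4)[OF dr] dX is_pullback_simps(1,2,5-7)[OF v]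
    HomD(1-3)[OF \<phi>(1)] Dom_Obj Cod_Obj
  note fs' = split_epiD(5)[OF fs] and dr' = split_epiD(5)[OF dr] and v' = is_pullbackD(5)[OF v]
  obtain p x where px: "is_pullback C p x f e"
    by (rule pullback_exists[OF fc, of f "Dom C f" "Cod C f" e "Dom C e"]) (simp_all add: Hom_def)
  note [simp] = is_pullback_simps(1,2,5-7)[OF px]
  note px' = is_pullbackD(5)[OF px]
  obtain \<theta> where \<theta>: "\<theta> \<in> Hom C (Dom C d) (Dom C p)" "p \<cdot> \<theta> = d" "x \<cdot> \<theta> = \<phi>"
    by (rule pullback_factor[OF px _ _ \<phi>(2)[symmetric]]) (simp_all add: Hom_def)
  note [simp] = HomD(1-3)[OF \<theta>(1)]
  note p\<theta> = comp_extend[OF \<theta>(2)] and x\<theta> = comp_extend[OF \<theta>(3)]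
  have pc: "split_epi C p (\<theta> \<cdot> r)"
    by (simp add: split_epi_def Hom_def p\<theta> dr')
  \<comment> \<open>Because \<open>f \<cdot> s\<close> and \<open>\<phi> \<cdot> v\<close> are
    identities, the factorization of \<open>(a, b)\<close> is \<open>x \<cdot> a\<close>.\<close>
  have w: "is_pullback C (\<theta> \<cdot> v) e p s"
  proof (rule is_pullbackI)
    show "\<theta> \<cdot> v \<in> Hom C (Dom C v) (Dom C p)" "e \<in> Hom C (Dom C v) (Cod C f)"
      "p \<in> Hom C (Dom C p) (Dom C f)" "s \<in> Hom C (Cod C f) (Dom C f)"
      by (simp_all add: Hom_def)
    show "p \<cdot> (\<theta> \<cdot> v) = s \<cdot> e"
      by (simp add: p\<theta> v')
  next
    fix z a b
    assume a: "a \<in> Hom C z (Dom C p)" and b: "b \<in> Hom C z (Cod C f)" and eq: "p \<cdot> a = s \<cdot> b"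
    note [simp] = HomD[OF a] HomD[OF b]
    have "f \<cdot> (p \<cdot> a) = b"
      by (simp add: eq comp_extend[OF fs'])
    then have exa: "e \<cdot> (x \<cdot> a) = b"
      by (simp add: comp_extend[OF px'])
    have "(\<theta> \<cdot> v) \<cdot> (x \<cdot> a) = a"
      by (rule pullback_unique[OF px, of _ z])
        (simp_all add: Hom_def p\<theta> x\<theta> comp_extend[OF v'] comp_extend[OF \<phi>v] exa eq)
    with exa show "\<exists>w\<in>Hom C z (Dom C v). (\<theta> \<cdot> v) \<cdot> w = a \<and> e \<cdot> w = b"
      by (intro bexI[of _ "x \<cdot> a"]) (simp_all add: Hom_def)
  next
    fix z w w'
    assume w: "w \<in> Hom C z (Dom C v)" "w' \<in> Hom C z (Dom C v)"
      and eq: "(\<theta> \<cdot> v) \<cdot> w = (\<theta> \<cdot> v) \<cdot> w'"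
    note [simp] = HomD[OF w(1)] HomD[OF w(2)]
    have "x \<cdot> (\<theta> \<cdot> (v \<cdot> w)) = x \<cdot> (\<theta> \<cdot> (v \<cdot> w'))"
      using eq by simp
    then show "w = w'"
      by (simp add: x\<theta> comp_extend[OF \<phi>v])
  qed
  obtain l where l: "l \<in> Hom C (Dom C p) (Dom C d)" "l \<cdot> \<theta> = Ident C (Dom C d)"
    "\<theta> \<cdot> l = Ident C (Dom C p)"
    by (rule protomodular_iso[OF assms(1) dr pc \<theta>(1,2) refl v w])
  note [simp] = HomD(1-3)[OF l(1)]
  show ?thesis
  proof (rule is_pullbackI)
    fix z a b
    assume a: "a \<in> Hom C z (Dom C f)" and b: "b \<in> Hom C z (Dom C e)" and eq: "f \<cdot> a = e \<cdot> b"
    obtain y where y: "y \<in> Hom C z (Dom C p)" "p \<cdot> y = a" "x \<cdot> y = b"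
      by (rule pullback_factor[OF px a b eq])
    note [simp] = HomD[OF y(1)]
    have "p \<cdot> (\<theta> \<cdot> (l \<cdot> y)) = a" "x \<cdot> (\<theta> \<cdot> (l \<cdot> y)) = b"
      by (simp_all add: comp_extend[OF l(3)] y)
    then show "\<exists>w\<in>Hom C z (Dom C d). d \<cdot> w = a \<and> \<phi> \<cdot> w = b"
      by (intro bexI[of _ "l \<cdot> y"]) (simp_all add: Hom_def p\<theta> x\<theta>)
  next
    fix z w w'
    assume w: "w \<in> Hom C z (Dom C d)" "w' \<in> Hom C z (Dom C d)"
      and eq: "d \<cdot> w = d \<cdot> w'" "\<phi> \<cdot> w = \<phi> \<cdot> w'"
    note [simp] = HomD[OF w(1)] HomD[OF w(2)]
    have "\<theta> \<cdot> w = \<theta> \<cdot> w'"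
      by (rule pullback_unique[OF px, of _ z]) (simp_all add: Hom_def p\<theta> x\<theta> eq)
    then have "l \<cdot> (\<theta> \<cdot> w) = l \<cdot> (\<theta> \<cdot> w')"
      by simp
    then show "w = w'"
      by (simp add: comp_extend[OF l(2)])
  qed (use \<phi> in \<open>simp_all add: Hom_def\<close>)
qed

section \<open>The decomposition given by a saturated relation\<close>

text \<open>Exactness gives the quotient \<open>kb\<close> of \<open>d\<^sub>0\<close>,
  \<open>d\<^sub>1\<close>. The inverse image along \<open>s\<close> is the kernel pair of
  \<open>kb \<cdot> s\<close>, hence has a quotient \<open>hb\<close>. Then \<open>fb\<close> and
  \<open>kc\<close> arise by descent along \<open>kb\<close>, and \<open>sb\<close> and
  \<open>hc\<close> by descent along \<open>hb\<close>.\<close>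

lemma saturated_quotient_decomposition:
  assumes exact: "exact_category C" and proto: "protomodular C"
    and hk: "point_mor C f s g t h k" and h: "kernel_pair C s\<^sub>0 s\<^sub>1 h"
    and T: "equivalence_relation C (Dom C f) d\<^sub>0 d\<^sub>1"
    and sat: "saturated C s d\<^sub>0 d\<^sub>1" and le: "inverse_image_le C s d\<^sub>0 d\<^sub>1 s\<^sub>0 s\<^sub>1"
  obtains fb sb hb kb hc kc where "decomposition C f s g t h k fb sb hb kb hc kc"
    and "kernel_pair C d\<^sub>0 d\<^sub>1 kb"
proof -
  have reg: "regular_category C"
    using exact by (simp add: exact_category_def)
  note [simp] = point_morD(1-14)[OF hk] Dom_Obj Cod_Obj
  note fs = point_morD(15)[OF hk] and hf = point_morD(17)[OF hk] and ks = point_morD(18)[OF hk]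
  have fs_split: "split_epi C f s"
    using hk by (simp add: point_mor_def)
  \<comment> \<open>Exactness only provides some \<open>q\<close> with this kernel pair; the
    coequalizer \<open>kb\<close> has the same kernel pair and is a regular epimorphism.\<close>
  obtain q where q: "kernel_pair C d\<^sub>0 d\<^sub>1 q"
    using exact T unfolding exact_category_def by blast
  obtain kb where kb: "is_coequalizer C kb d\<^sub>0 d\<^sub>1"
    using reg q unfolding regular_category_def by blast
  have kb_reg: "regular_epi C kb"
    using kb by (auto simp: regular_epi_def)
  have kbT: "kernel_pair C d\<^sub>0 d\<^sub>1 kb"
    by (rule kernel_pair_coequalizer[OF q kb])
  have kbX: "Dom C kb = Dom C f"
    using T kernel_pairD(4)[OF kbT] by (auto simp: equivalence_relation_def Hom_def)
  note [simp] = kernel_pairD(1-6)[OF kbT] kbX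
  note kbd = kernel_pairD(7)[OF kbT]
  obtain r where r: "r \<in> Hom C (Dom C f) (Dom C d\<^sub>0)" "d\<^sub>0 \<cdot> r = Ident C (Dom C f)"
    "d\<^sub>1 \<cdot> r = Ident C (Dom C f)"
    using T by (auto simp: equivalence_relation_def)
  note [simp] = HomD(1-3)[OF r(1)]
  have dr: "split_epi C d\<^sub>0 r"
    using r by (simp add: split_epi_def)
  obtain e\<^sub>0 e\<^sub>1 v where inv: "inverse_image C s d\<^sub>0 d\<^sub>1 e\<^sub>0 e\<^sub>1 v" and v: "is_pullback C v e\<^sub>0 d\<^sub>0 s"
    using sat by (auto simp: saturated_def)
  note I = inverse_imageD[OF inv]
  have [simp]: "e\<^sub>0 \<in> Arr C" "e\<^sub>1 \<in> Arr C" "v \<in> Arr C" "Dom C e\<^sub>1 = Dom C e\<^sub>0" "Cod C e\<^sub>0 = Cod C f"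
    "Cod C e\<^sub>1 = Cod C f" "Dom C v = Dom C e\<^sub>0" "Cod C v = Dom C d\<^sub>0"
    using I by simp_all
  have kbs: "kernel_pair C e\<^sub>0 e\<^sub>1 (kb \<cdot> s)"
    by (rule inverse_image_kernel_pair[OF inv kbT])
  obtain hb where hb: "is_coequalizer C hb e\<^sub>0 e\<^sub>1"
    using reg kbs unfolding regular_category_def by blast
  have hb_reg: "regular_epi C hb"
    using hb by (auto simp: regular_epi_def)
  have hbS: "kernel_pair C e\<^sub>0 e\<^sub>1 hb"
    by (rule kernel_pair_coequalizer[OF kbs hb])
  have hbY: "Dom C hb = Cod C f"
    using kernel_pairD(4)[OF hbS] by simp
  note [simp] = kernel_pairD(3)[OF hbS] hbY
  note hbe = kernel_pairD(7)[OF hbS]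
  \<comment> \<open>\<open>saturated\<close> and \<open>inverse_image_le\<close> each choose their
    own inverse image; \<open>w\<close> compares the two, both being kernel pairs of
    \<open>kb \<cdot> s\<close>. The inclusion \<open>j\<close> then lands in the kernel pair of
    \<open>h\<close>.\<close>
  have he: "h \<cdot> e\<^sub>0 = h \<cdot> e\<^sub>1"
  proof -
    obtain a b x where inv': "inverse_image C s d\<^sub>0 d\<^sub>1 a b x" and ab: "relation_le C a b s\<^sub>0 s\<^sub>1"
      using le by (auto simp: inverse_image_le_def)
    obtain j where j: "j \<in> Hom C (Dom C a) (Dom C s\<^sub>0)" "s\<^sub>0 \<cdot> j = a" "s\<^sub>1 \<cdot> j = b"
      using ab by (auto simp: relation_le_def)
    obtain w where w: "w \<in> Hom C (Dom C e\<^sub>0) (Dom C a)" "a \<cdot> w = e\<^sub>0" "b \<cdot> w = e\<^sub>1"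
      by (rule kernel_pair_factor[OF inverse_image_kernel_pair[OF inv' kbT] _ _ kernel_pairD(7)[OF kbs]])
        (simp_all add: Hom_def)
    note [simp] = HomD(1-3)[OF j(1)] HomD(1-3)[OF w(1)] kernel_pairD(1,2,4-6)[OF h]
    have "s\<^sub>0 \<cdot> (j \<cdot> w) = e\<^sub>0" "s\<^sub>1 \<cdot> (j \<cdot> w) = e\<^sub>1"
      by (simp_all add: comp_extend[OF j(2)] comp_extend[OF j(3)] w)
    then show ?thesis
      using comp_extend[OF kernel_pairD(7)[OF h], of "j \<cdot> w"] by simp
  qed
  \<comment> \<open>\<open>c \<cdot> d\<^sub>0\<close> and \<open>c \<cdot> d\<^sub>1\<close> agree
    on the diagonal \<open>r\<close> in any case, and on \<open>v\<close> by the assumption on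
    \<open>c \<cdot> s\<close>; \<open>r\<close> and \<open>v\<close> are jointly epic.\<close>
  have invariant: "c \<cdot> d\<^sub>0 = c \<cdot> d\<^sub>1" if c: "c \<in> Hom C (Dom C f) B" "(c \<cdot> s) \<cdot> e\<^sub>0 = (c \<cdot> s) \<cdot> e\<^sub>1" for c B
  proof (rule protomodular_jointly_epic[OF proto dr v])
    note [simp] = HomD[OF c(1)]
    show "c \<cdot> d\<^sub>0 \<in> Hom C (Dom C d\<^sub>0) B" "c \<cdot> d\<^sub>1 \<in> Hom C (Dom C d\<^sub>0) B"
      by (simp_all add: Hom_def)
    show "(c \<cdot> d\<^sub>0) \<cdot> v = (c \<cdot> d\<^sub>1) \<cdot> v" "(c \<cdot> d\<^sub>0) \<cdot> r = (c \<cdot> d\<^sub>1) \<cdot> r"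
      using c(2) by (simp_all add: I(15,16) r)
  qed
  have hbf: "(hb \<cdot> f) \<cdot> s = hb"
    by (simp add: fs)
  have hbfd: "(hb \<cdot> f) \<cdot> d\<^sub>0 = (hb \<cdot> f) \<cdot> d\<^sub>1"
    by (rule invariant[of _ "Cod C hb"], simp add: Hom_def, unfold hbf, rule hbe)
  obtain fb where fb: "fb \<in> Hom C (Cod C kb) (Cod C hb)" "fb \<cdot> kb = hb \<cdot> f"
    by (rule coequalizer_factor[OF kb _ hbfd]) (simp add: Hom_def)
  obtain sb where sb: "sb \<in> Hom C (Cod C hb) (Cod C kb)" "sb \<cdot> hb = kb \<cdot> s"
    by (rule coequalizer_factor[OF hb _ kernel_pairD(7)[OF kbs]]) (simp add: Hom_def)
  obtain hc where hc: "hc \<in> Hom C (Cod C hb) (Cod C g)" "hc \<cdot> hb = h"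
    by (rule coequalizer_factor[OF hb _ he]) (simp add: Hom_def)
  have "k \<cdot> d\<^sub>0 = k \<cdot> d\<^sub>1"
    by (rule invariant[of _ "Dom C g"]) (simp_all add: Hom_def comp_extend[OF ks] he)
  then obtain kc where kc: "kc \<in> Hom C (Cod C kb) (Dom C g)" "kc \<cdot> kb = k"
    by (rule coequalizer_factor[OF kb, rotated]) (simp_all add: Hom_def)
  note [simp] = HomD(1-3)[OF fb(1)] HomD(1-3)[OF sb(1)] HomD(1-3)[OF hc(1)] HomD(1-3)[OF kc(1)]
  have "fb \<cdot> (sb \<cdot> hb) = (fb \<cdot> kb) \<cdot> s"
    by (simp add: sb(2))
  also have "\<dots> = hb"
    using hbf by (simp add: fb(2))
  finally have "fb \<cdot> sb = Ident C (Cod C hb)"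
    by - (rule regular_epi_cancel[OF hb_reg, of _ "Cod C hb"], simp_all add: Hom_def)
  then have split: "split_epi C fb sb"
    by (simp add: split_epi_def Hom_def)
  have hbkb: "point_mor C f s fb sb hb kb"
    using fs_split split fb sb by (simp add: point_mor_def Hom_def)
  have "g \<cdot> kc = hc \<cdot> fb"
    by (rule regular_epi_cancel[OF kb_reg, of _ "Cod C g"])
      (simp_all add: Hom_def kc fb hf comp_extend[OF hc(2)])
  moreover have "kc \<cdot> sb = t \<cdot> hc"
    by (rule regular_epi_cancel[OF hb_reg, of _ "Dom C g"])
      (simp_all add: Hom_def sb hc ks comp_extend[OF kc(2)])
  ultimately have hckc: "point_mor C fb sb g t hc kc"
    using hk split by (simp add: point_mor_def Hom_def)
  \<comment> \<open>\<open>\<phi>\<close> is the action of \<open>f\<close> on related pairs, from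
    \<open>d\<^sub>0\<close>, \<open>d\<^sub>1\<close> to \<open>e\<^sub>0\<close>,
    \<open>e\<^sub>1\<close>; as \<open>f \<cdot> s\<close> is an identity, it is a retraction of
    \<open>v\<close>.\<close>
  obtain \<phi> where \<phi>: "\<phi> \<in> Hom C (Dom C d\<^sub>0) (Dom C e\<^sub>0)" "e\<^sub>0 \<cdot> \<phi> = f \<cdot> d\<^sub>0" "e\<^sub>1 \<cdot> \<phi> = f \<cdot> d\<^sub>1"
    by (rule kernel_pair_factor[OF hbS, of "f \<cdot> d\<^sub>0" "Dom C d\<^sub>0" "f \<cdot> d\<^sub>1"])
      (use hbfd in \<open>simp_all add: Hom_def\<close>)
  note [simp] = HomD(1-3)[OF \<phi>(1)]
  have "\<phi> \<cdot> v = Ident C (Dom C e\<^sub>0)"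
    by (rule kernel_pair_unique[OF hbS, of _ "Dom C e\<^sub>0"])
      (simp_all add: Hom_def comp_extend[OF \<phi>(2)] comp_extend[OF \<phi>(3)] I(15,16) comp_extend[OF fs])
  then have T_fib: "is_pullback C d\<^sub>0 \<phi> f e\<^sub>0"
    by (rule protomodular_discrete_fibration[OF proto fs_split dr v \<phi>(1,2)])
  have "is_pullback C kb f fb hb"
    by (rule barr_kock[OF reg kb_reg kbT hbS _ fb T_fib \<phi>(3)]) (simp add: Hom_def)
  then have "decomposition C f s g t h k fb sb hb kb hc kc"
    unfolding decomposition_def using split hbkb hckc hc kc hb_reg by simp
  then show ?thesis
    using kbT by (rule that)
qed

section \<open>Comparison with competing decompositions\<close>

text \<open>Since \<open>\<kappa> \<cdot> s = s' \<cdot> \<chi>\<close> and \<open>s'\<close> is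
  monic, the kernel pair of \<open>\<chi>\<close> is the inverse image of that of
  \<open>\<kappa>\<close>. Whatever \<open>\<kappa>\<close> identifies with a value of
  \<open>s\<close> is again a value of \<open>s\<close>, because the square over
  \<open>\<chi>\<close> is a pullback; this is saturation.\<close>

lemma cartesian_kernel_pair_saturated:
  assumes \<chi>\<kappa>: "cartesian_mor C f s f' s' \<chi> \<kappa>"
    and \<kappa>: "kernel_pair C d\<^sub>0 d\<^sub>1 \<kappa>" and \<chi>: "kernel_pair C e\<^sub>0 e\<^sub>1 \<chi>"
  obtains v where "inverse_image C s d\<^sub>0 d\<^sub>1 e\<^sub>0 e\<^sub>1 v" and "is_pullback C v e\<^sub>0 d\<^sub>0 s"
proof -
  have pm: "point_mor C f s f' s' \<chi> \<kappa>" and pb: "is_pullback C \<kappa> f f' \<chi>"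
    using \<chi>\<kappa> by (auto simp: cartesian_mor_def)
  note [simp] = point_morD(1-14)[OF pm] kernel_pairD(1,2,4-6)[OF \<kappa>] kernel_pairD(1,2,4-6)[OF \<chi>]
    Dom_Obj Cod_Obj
  note fs = point_morD(15)[OF pm] and fs' = point_morD(16)[OF pm]
    and sq = point_morD(17)[OF pm] and ks = point_morD(18)[OF pm]
  have "monic C s'"
    using pm split_epi_monic unfolding point_mor_def by blast
  then have "kernel_pair C e\<^sub>0 e\<^sub>1 (\<kappa> \<cdot> s)"
    unfolding ks by (rule kernel_pair_comp_monic[OF \<chi>]) simp
  then obtain v where v: "inverse_image C s d\<^sub>0 d\<^sub>1 e\<^sub>0 e\<^sub>1 v"
    by (rule kernel_pair_inverse_image[OF _ \<kappa>]) simp_all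
  note I = inverse_imageD(6,13-16)[OF v]
  note [simp] = I(1-3)
  have "is_pullback C v e\<^sub>0 d\<^sub>0 s"
  proof (rule is_pullbackI)
    show "v \<in> Hom C (Dom C e\<^sub>0) (Dom C d\<^sub>0)" "e\<^sub>0 \<in> Hom C (Dom C e\<^sub>0) (Cod C f)"
      "d\<^sub>0 \<in> Hom C (Dom C d\<^sub>0) (Dom C f)" "s \<in> Hom C (Cod C f) (Dom C f)"
      by (simp_all add: Hom_def)
    show "d\<^sub>0 \<cdot> v = s \<cdot> e\<^sub>0"
      by (rule I)
  next
    fix z a b
    assume a: "a \<in> Hom C z (Dom C d\<^sub>0)" and b: "b \<in> Hom C z (Cod C f)" and eq: "d\<^sub>0 \<cdot> a = s \<cdot> b"
    note [simp] = HomD[OF a] HomD[OF b]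
    have "\<kappa> \<cdot> (d\<^sub>1 \<cdot> a) = \<kappa> \<cdot> (d\<^sub>0 \<cdot> a)"
      by (simp add: comp_extend[OF kernel_pairD(7)[OF \<kappa>]])
    then have \<kappa>d: "\<kappa> \<cdot> (d\<^sub>1 \<cdot> a) = s' \<cdot> (\<chi> \<cdot> b)"
      by (simp add: eq comp_extend[OF ks])
    have "\<chi> \<cdot> (f \<cdot> (d\<^sub>1 \<cdot> a)) = f' \<cdot> (\<kappa> \<cdot> (d\<^sub>1 \<cdot> a))"
      by (simp add: comp_extend[OF sq])
    then have \<chi>fd: "\<chi> \<cdot> (f \<cdot> (d\<^sub>1 \<cdot> a)) = \<chi> \<cdot> b"
      by (simp add: \<kappa>d comp_extend[OF fs'])
    \<comment> \<open>\<open>d\<^sub>1 \<cdot> a\<close> and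
      \<open>s \<cdot> (f \<cdot> (d\<^sub>1 \<cdot> a))\<close> agree after \<open>\<kappa>\<close>
      and after \<open>f\<close>, the projections of the pullback. So
      \<open>d\<^sub>1 \<cdot> a\<close> factors through \<open>s\<close>, and
      \<open>(b, f \<cdot> (d\<^sub>1 \<cdot> a))\<close> is the required pair.\<close>
    have sfd: "s \<cdot> (f \<cdot> (d\<^sub>1 \<cdot> a)) = d\<^sub>1 \<cdot> a"
      by (rule pullback_unique[OF pb, of _ z])
        (simp_all add: Hom_def comp_extend[OF ks] comp_extend[OF fs] \<chi>fd \<kappa>d)
    have "\<exists>!w. w \<in> Hom C z (Dom C e\<^sub>0) \<and> e\<^sub>0 \<cdot> w = b \<and> e\<^sub>1 \<cdot> w = f \<cdot> (d\<^sub>1 \<cdot> a) \<and> v \<cdot> w = a"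
      by (rule inverse_image_ex1[OF v]) (simp_all add: Hom_def eq sfd)
    then show "\<exists>w\<in>Hom C z (Dom C e\<^sub>0). v \<cdot> w = a \<and> e\<^sub>0 \<cdot> w = b"
      by blast
  next
    fix z w w'
    assume w: "w \<in> Hom C z (Dom C e\<^sub>0)" "w' \<in> Hom C z (Dom C e\<^sub>0)"
      and eq: "v \<cdot> w = v \<cdot> w'" "e\<^sub>0 \<cdot> w = e\<^sub>0 \<cdot> w'"
    note [simp] = HomD[OF w(1)] HomD[OF w(2)]
    have fd: "f \<cdot> (d\<^sub>1 \<cdot> v) = e\<^sub>1"
      by (simp add: I(5) comp_extend[OF fs])
    have "f \<cdot> (d\<^sub>1 \<cdot> (v \<cdot> w)) = f \<cdot> (d\<^sub>1 \<cdot> (v \<cdot> w'))"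
      using eq by simp
    then have "e\<^sub>1 \<cdot> w = e\<^sub>1 \<cdot> w'"
      by (simp add: comp_extend[OF I(5)] comp_extend[OF fs])
    then show "w = w'"
      using kernel_pair_unique[OF \<chi> w] eq by blast
  qed
  with v show ?thesis
    by (rule that)
qed

lemma decompositionD:
  assumes "decomposition C f s g t h k f' s' h\<^sub>1 k\<^sub>1 h\<^sub>2 k\<^sub>2"
  shows "point_mor C f s f' s' h\<^sub>1 k\<^sub>1" and "point_mor C f' s' g t h\<^sub>2 k\<^sub>2"
    and "h\<^sub>2 \<cdot> h\<^sub>1 = h" and "k\<^sub>2 \<cdot> k\<^sub>1 = k" and "regular_epi C h\<^sub>1"
    and "cartesian_mor C f s f' s' h\<^sub>1 k\<^sub>1"
  using assms by (simp_all add: decomposition_def cartesian_mor_def)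

lemma cartesian_regular_epi:
  assumes "regular_category C" and "cartesian_mor C f s g t h k" and "regular_epi C h"
  shows "regular_epi C k"
  using assms unfolding regular_category_def cartesian_mor_def by blast

text \<open>\<open>k\<^sub>1\<close> is a regular epimorphism by stability under pullback, and the
  inclusion \<open>le\<close> of kernel pairs lets \<open>kb\<close> descend along it to
  \<open>\<kappa>\<close>. Compatibility and uniqueness follow by cancelling
  \<open>h\<^sub>1\<close> or \<open>k\<^sub>1\<close>. Unique existence is asserted of the pair,
  since nested unique quantifiers would not express joint uniqueness.\<close>

lemma decomposition_mediating:
  assumes reg: "regular_category C"
    and D: "decomposition C f s g t h k fb sb hb kb hc kc"
    and D': "decomposition C f s g t h k f' s' h\<^sub>1 k\<^sub>1 h\<^sub>2 k\<^sub>2"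
    and kb: "kernel_pair C d\<^sub>0 d\<^sub>1 kb" and k1: "kernel_pair C t\<^sub>0 t\<^sub>1 k\<^sub>1"
    and le: "relation_le C t\<^sub>0 t\<^sub>1 d\<^sub>0 d\<^sub>1"
  shows "\<exists>!m. case m of (\<chi>, \<kappa>) \<Rightarrow>
    point_mor C f' s' fb sb \<chi> \<kappa> \<and> \<chi> \<cdot> h\<^sub>1 = hb \<and> \<kappa> \<cdot> k\<^sub>1 = kb \<and>
    hc \<cdot> \<chi> = h\<^sub>2 \<and> kc \<cdot> \<kappa> = k\<^sub>2"
proof -
  note p = decompositionD[OF D] and p' = decompositionD[OF D']
  note [simp] = point_morD(1-14)[OF p(1)] point_morD(5,6,11-14)[OF p(2)]
    point_morD(3-6,9-14)[OF p'(1)] point_morD(5,6,11-14)[OF p'(2)] Dom_Obj Cod_Obj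
  have k1_reg: "regular_epi C k\<^sub>1"
    using cartesian_regular_epi[OF reg p'(6,5)] .
  \<comment> \<open>\<open>regular_epi\<close> provides just some presenting pair; it factors
    through the kernel pair of \<open>k\<^sub>1\<close>, hence through \<open>d\<^sub>0\<close>,
    \<open>d\<^sub>1\<close>, which \<open>kb\<close> coequalizes.\<close>
  then obtain a b where ab: "is_coequalizer C k\<^sub>1 a b"
    by (auto simp: regular_epi_def)
  note ab' = coequalizerD(2-4)[OF ab, simplified]
  have [simp]: "a \<in> Arr C" "b \<in> Arr C" "Cod C a = Dom C f" "Cod C b = Dom C f" "Dom C b = Dom C a"
    using ab' by (simp_all add: Hom_def)
  obtain w where w: "w \<in> Hom C (Dom C a) (Dom C t\<^sub>0)" "t\<^sub>0 \<cdot> w = a" "t\<^sub>1 \<cdot> w = b"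
    by (rule kernel_pair_factor[OF k1 _ _ ab'(3)]) (simp_all add: Hom_def)
  obtain j where j: "j \<in> Hom C (Dom C t\<^sub>0) (Dom C d\<^sub>0)" "d\<^sub>0 \<cdot> j = t\<^sub>0" "d\<^sub>1 \<cdot> j = t\<^sub>1"
    using le by (auto simp: relation_le_def)
  note [simp] = HomD(1-3)[OF w(1)] HomD(1-3)[OF j(1)] kernel_pairD(1,2,4-6)[OF kb]
  have "d\<^sub>0 \<cdot> (j \<cdot> w) = a" "d\<^sub>1 \<cdot> (j \<cdot> w) = b"
    by (simp_all add: comp_extend[OF j(2)] comp_extend[OF j(3)] w)
  then have "kb \<cdot> a = kb \<cdot> b"
    using comp_extend[OF kernel_pairD(7)[OF kb], of "j \<cdot> w"] by simp
  then obtain \<kappa> where \<kappa>: "\<kappa> \<in> Hom C (Dom C f') (Dom C fb)" "\<kappa> \<cdot> k\<^sub>1 = kb"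
    using coequalizer_factor[OF ab, of kb "Dom C fb"] by (auto simp: Hom_def)
  note [simp] = HomD(1-3)[OF \<kappa>(1)]
  \<comment> \<open>The only possible choice: a morphism of points satisfies
    \<open>\<kappa> \<cdot> s' = sb \<cdot> \<chi>\<close>, and \<open>fb \<cdot> sb\<close> is an
    identity.\<close>
  define \<chi> where "\<chi> = fb \<cdot> (\<kappa> \<cdot> s')"
  have [simp]: "\<chi> \<in> Arr C" "Dom C \<chi> = Cod C f'" "Cod C \<chi> = Cod C fb"
    by (simp_all add: \<chi>_def)
  have \<chi>: "\<chi> \<cdot> h\<^sub>1 = hb"
  proof -
    have "\<chi> \<cdot> h\<^sub>1 = fb \<cdot> (\<kappa> \<cdot> (k\<^sub>1 \<cdot> s))"
      by (simp add: \<chi>_def point_morD(18)[OF p'(1)])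
    also have "\<dots> = fb \<cdot> (kb \<cdot> s)"
      by (simp add: comp_extend[OF \<kappa>(2)])
    also have "\<dots> = hb"
      by (simp add: point_morD(18)[OF p(1)] comp_extend[OF point_morD(16)[OF p(1)]])
    finally show ?thesis .
  qed
  note cancel_h = regular_epi_cancel[OF p'(5)] and cancel_k = regular_epi_cancel[OF k1_reg]
  have "fb \<cdot> \<kappa> = \<chi> \<cdot> f'"
    by (rule cancel_k[of _ "Cod C fb"])
      (simp_all add: Hom_def \<kappa> point_morD(17)[OF p(1)] point_morD(17)[OF p'(1)] comp_extend[OF \<chi>])
  moreover have "\<kappa> \<cdot> s' = sb \<cdot> \<chi>"
    by (rule cancel_h[of _ "Dom C fb"])
      (simp_all add: Hom_def \<chi> point_morD(18)[OF p(1), symmetric] comp_extend[OF \<kappa>(2)]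
        flip: point_morD(18)[OF p'(1)])
  ultimately have m: "point_mor C f' s' fb sb \<chi> \<kappa>"
    using p(1) p'(1) by (simp add: point_mor_def Hom_def)
  have hc\<chi>: "hc \<cdot> \<chi> = h\<^sub>2"
    by (rule cancel_h[of _ "Cod C g"]) (simp_all add: Hom_def \<chi> p(3) p'(3))
  have kc\<kappa>: "kc \<cdot> \<kappa> = k\<^sub>2"
    by (rule cancel_k[of _ "Dom C g"]) (simp_all add: Hom_def \<kappa> p(4) p'(4))
  show ?thesis
  proof (rule ex1I[of _ "(\<chi>, \<kappa>)"])
    show "case (\<chi>, \<kappa>) of (\<chi>, \<kappa>) \<Rightarrow>
      point_mor C f' s' fb sb \<chi> \<kappa> \<and> \<chi> \<cdot> h\<^sub>1 = hb \<and> \<kappa> \<cdot> k\<^sub>1 = kb \<and>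
      hc \<cdot> \<chi> = h\<^sub>2 \<and> kc \<cdot> \<kappa> = k\<^sub>2"
      unfolding prod.case using m \<chi> \<kappa>(2) hc\<chi> kc\<kappa> by blast
  next
    fix m
    assume "case m of (\<chi>', \<kappa>') \<Rightarrow>
      point_mor C f' s' fb sb \<chi>' \<kappa>' \<and> \<chi>' \<cdot> h\<^sub>1 = hb \<and> \<kappa>' \<cdot> k\<^sub>1 = kb \<and>
      hc \<cdot> \<chi>' = h\<^sub>2 \<and> kc \<cdot> \<kappa>' = k\<^sub>2"
    then obtain \<chi>' \<kappa>' where m: "m = (\<chi>', \<kappa>')" and pm: "point_mor C f' s' fb sb \<chi>' \<kappa>'"
      and eq: "\<chi>' \<cdot> h\<^sub>1 = hb" "\<kappa>' \<cdot> k\<^sub>1 = kb"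
      by (cases m) auto
    have "\<chi>' = \<chi>"
      by (rule cancel_h[of _ "Cod C fb"]) (use pm eq \<chi> in \<open>simp_all add: Hom_def point_mor_def\<close>)
    moreover have "\<kappa>' = \<kappa>"
      by (rule cancel_k[of _ "Dom C fb"]) (use pm eq \<kappa> in \<open>simp_all add: Hom_def point_mor_def\<close>)
    ultimately show "m = (\<chi>, \<kappa>)"
      by (simp add: m)
  qed
qed

lemma kernel_pair_exists:
  assumes "finitely_complete C" and "f \<in> Arr C"
  obtains a b where "kernel_pair C a b f"
proof -
  have "f \<in> Hom C (Dom C f) (Cod C f)"
    using assms(2) by (simp add: Hom_def)
  then show ?thesis
    using pullback_exists[OF assms(1)] that unfolding kernel_pair_def by blast
qed

end

section \<open>Universality from the largest saturated relation\<close>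

theorem proposition4p2:
  fixes C :: "('o, 'a) cat"
  assumes "exact_category C" and "Equ_saturating C" and "protomodular C"
    and "f \<in> Hom C X Y" and "s \<in> Hom C Y X" and "f \<cdot>\<^bsub>C\<^esub> s = Ident C Y"
    and "g \<in> Hom C V W" and "t \<in> Hom C W V" and "g \<cdot>\<^bsub>C\<^esub> t = Ident C W"
    and "k \<in> Hom C X V" and "regular_epi C k"
    and "h \<in> Hom C Y W" and "regular_epi C h"
    and "g \<cdot>\<^bsub>C\<^esub> k = h \<cdot>\<^bsub>C\<^esub> f" and "k \<cdot>\<^bsub>C\<^esub> s = t \<cdot>\<^bsub>C\<^esub> h"
  shows "\<exists>fb sb hb kb hc kc.
    decomposition C f s g t h k fb sb hb kb hc kc \<and>
    (\<forall>f' s' \<chi>b \<kappa>b \<chi>c \<kappa>c.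
      decomposition C f s g t h k f' s' \<chi>b \<kappa>b \<chi>c \<kappa>c \<longrightarrow>
      (\<exists>!m. case m of (\<chi>, \<kappa>) \<Rightarrow>
        point_mor C f' s' fb sb \<chi> \<kappa> \<and>
        \<chi> \<cdot>\<^bsub>C\<^esub> \<chi>b = hb \<and> \<kappa> \<cdot>\<^bsub>C\<^esub> \<kappa>b = kb \<and>
        hc \<cdot>\<^bsub>C\<^esub> \<chi> = \<chi>c \<and> kc \<cdot>\<^bsub>C\<^esub> \<kappa> = \<kappa>c))"
proof -
  have fc: "finitely_complete C" and reg: "regular_category C"
    using assms(1) by (simp_all add: exact_category_def regular_category_def)
  interpret category C
    using fc by (simp add: finitely_complete_def)
  have hk: "point_mor C f s g t h k"
    using assms by (auto simp: point_mor_def split_epi_def Hom_def)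
  note [simp] = point_morD(1-14)[OF hk]
  have s: "monic C s"
    using hk split_epi_monic unfolding point_mor_def by blast
  obtain s\<^sub>0 s\<^sub>1 where h: "kernel_pair C s\<^sub>0 s\<^sub>1 h"
    by (rule kernel_pair_exists[OF fc, of h]) simp_all
  \<comment> \<open>The saturating property is applied to the monomorphism \<open>s\<close> and the
    kernel pair of \<open>h\<close>, a relation on the domain of \<open>s\<close>.\<close>
  have S: "equivalence_relation C (Dom C s) s\<^sub>0 s\<^sub>1"
    using kernel_pair_equivalence_relation[OF fc h] by simp
  then obtain d\<^sub>0 d\<^sub>1 where T: "equivalence_relation C (Cod C s) d\<^sub>0 d\<^sub>1" "saturated C s d\<^sub>0 d\<^sub>1"
      "inverse_image_le C s d\<^sub>0 d\<^sub>1 s\<^sub>0 s\<^sub>1"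
    and largest: "\<And>t\<^sub>0 t\<^sub>1. equivalence_relation C (Cod C s) t\<^sub>0 t\<^sub>1 \<Longrightarrow> saturated C s t\<^sub>0 t\<^sub>1 \<Longrightarrow>
      inverse_image_le C s t\<^sub>0 t\<^sub>1 s\<^sub>0 s\<^sub>1 \<Longrightarrow> relation_le C t\<^sub>0 t\<^sub>1 d\<^sub>0 d\<^sub>1"
    using assms(2) s unfolding Equ_saturating_def by blast
  have T1: "equivalence_relation C (Dom C f) d\<^sub>0 d\<^sub>1"
    using T(1) by simp
  obtain fb sb hb kb hc kc where D: "decomposition C f s g t h k fb sb hb kb hc kc"
    and kb: "kernel_pair C d\<^sub>0 d\<^sub>1 kb"
    by (rule saturated_quotient_decomposition[OF assms(1,3) hk h T1 T(2,3)])
  have "\<exists>!m. case m of (\<chi>, \<kappa>) \<Rightarrow>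
        point_mor C f' s' fb sb \<chi> \<kappa> \<and> \<chi> \<cdot>\<^bsub>C\<^esub> \<chi>b = hb \<and> \<kappa> \<cdot>\<^bsub>C\<^esub> \<kappa>b = kb \<and>
        hc \<cdot>\<^bsub>C\<^esub> \<chi> = \<chi>c \<and> kc \<cdot>\<^bsub>C\<^esub> \<kappa> = \<kappa>c"
    if D': "decomposition C f s g t h k f' s' \<chi>b \<kappa>b \<chi>c \<kappa>c" for f' s' \<chi>b \<kappa>b \<chi>c \<kappa>c
  proof -
    note p = decompositionD[OF D']
    note [simp] = point_morD(3-6,9-14)[OF p(1)] point_morD(5,6,11-14)[OF p(2)]
    obtain t\<^sub>0 t\<^sub>1 where t: "kernel_pair C t\<^sub>0 t\<^sub>1 \<kappa>b"
      by (rule kernel_pair_exists[OF fc, of \<kappa>b]) simp_all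
    obtain e\<^sub>0 e\<^sub>1 where e: "kernel_pair C e\<^sub>0 e\<^sub>1 \<chi>b"
      by (rule kernel_pair_exists[OF fc, of \<chi>b]) simp_all
    note [simp] = kernel_pairD(1,2,4-6)[OF e]
    obtain v where v: "inverse_image C s t\<^sub>0 t\<^sub>1 e\<^sub>0 e\<^sub>1 v" "is_pullback C v e\<^sub>0 t\<^sub>0 s"
      by (rule cartesian_kernel_pair_saturated[OF p(6) t e])
    \<comment> \<open>\<open>h\<close> factors through \<open>\<chi>b\<close>, so the kernel pair of
      \<open>\<chi>b\<close> lies in that of \<open>h\<close>. It is also the inverse image along
      \<open>s\<close> of the kernel pair of \<open>\<kappa>b\<close>, which therefore lies in the
      largest relation.\<close>
    have "\<chi>c \<cdot>\<^bsub>C\<^esub> (\<chi>b \<cdot>\<^bsub>C\<^esub> e\<^sub>0) = \<chi>c \<cdot>\<^bsub>C\<^esub> (\<chi>b \<cdot>\<^bsub>C\<^esub> e\<^sub>1)"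
      by (simp add: kernel_pairD(7)[OF e])
    then have "h \<cdot>\<^bsub>C\<^esub> e\<^sub>0 = h \<cdot>\<^bsub>C\<^esub> e\<^sub>1"
      by (simp add: comp_extend[OF p(3)])
    then have "relation_le C e\<^sub>0 e\<^sub>1 s\<^sub>0 s\<^sub>1"
      unfolding relation_le_def using kernel_pair_factor[OF h, of e\<^sub>0 "Dom C e\<^sub>0" e\<^sub>1]
      by (auto simp: Hom_def)
    moreover have "equivalence_relation C (Cod C s) t\<^sub>0 t\<^sub>1"
      using kernel_pair_equivalence_relation[OF fc t] by simp
    ultimately have "relation_le C t\<^sub>0 t\<^sub>1 d\<^sub>0 d\<^sub>1"
      using largest v unfolding saturated_def inverse_image_le_def by blast
    then show ?thesis
      by (rule decomposition_mediating[OF reg D D' kb t])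
  qed
  with D show ?thesis
    by blast
qed

end
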